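(* Let $m\ge 1$ and let $T,T'$ be triangulations of the polygon $P_{m+1}$. Then $c(T)=c(T')$ if and only if $T'$ can be obtained from $T$ by a finite sequence of hexagonal moves.
   Context: $P_{m+1}$ is a convex polygon with vertices labeled $0,1,\dots,m$ in clockwise order; a triangulation is a maximal set of pairwise non-crossing diagonals. Let $\mathbb{F}_2\mathbb{P}^1=\{\mathbf{0}=[1:0],\ \mathbf{1}=[1:1],\ \infty=[0:1]\}$ and let $X_{\mathbb{F}_2}(m)$ be the set of tuples $(y_0,\dots,y_m)\in(\mathbb{F}_2\mathbb{P}^1)^{m+1}$ with $y_0=\mathbf{0}$, $y_m=\infty$ and $y_i\neq y_{i+1}$ for $0\le i\le m-1$. For a triangulation $T$ of $P_{m+1}$, $c(T)\in X_{\mathbb{F}_2}(m)$ denotes the unique tuple $(y_0,\dots,y_m)$ with $y_0=\mathbf{0}$, $y_m=\infty$ and $y_i\neq y_j$ whenever $ij$ is a side of $P_{m+1}$ or a diagonal of $T$ (i.e. the unique proper 3-coloring of the triangulation graph with the colors of vertices $0$ and $m$ prescribed). A hexagonal move on a triangulation $T$ is the following local change: take six vertices $u_1,\dots,u_6$ of $P_{m+1}$ in cyclic order such that each of $u_1u_2,u_2u_3,\dots,u_6u_1$ is a side of $P_{m+1}$ or a diagonal of $T$ (so they bound a hexagon triangulated by $T$), and if the three diagonals of $T$ inside this hexagon are $\{u_1u_3,u_3u_6,u_6u_4\}$ (resp. $\{u_1u_5,u_5u_2,u_2u_4\}$) replace them by $\{u_1u_5,u_5u_2,u_2u_4\}$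 (resp. $\{u_1u_3,u_3u_6,u_6u_4\}$) (zig-zag move), or if they are $\{u_1u_3,u_3u_5,u_5u_1\}$ (resp. $\{u_2u_4,u_4u_6,u_6u_2\}$) replace them by $\{u_2u_4,u_4u_6,u_6u_2\}$ (resp. $\{u_1u_3,u_3u_5,u_5u_1\}$) (inscribed triangle move). *)

theory Defs
  imports Main "HOL-Library.Z2"
begin

definition proj_rel :: "bit \<times> bit \<Rightarrow> bit \<times> bit \<Rightarrow> bool" where
  "proj_rel v w \<longleftrightarrow> v \<noteq> (0, 0) \<and> w \<noteq> (0, 0) \<and>
     (\<exists>c. c \<noteq> 0 \<and> w = (c * fst v, c * snd v))"

lemma proj_rel_iff: "proj_rel v w \<longleftrightarrow> v \<noteq> (0, 0) \<and> v = w"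
proof -
  have "c \<noteq> 0 \<longleftrightarrow> c = 1" for c :: bit
    by (cases c) auto
  then show ?thesis
    unfolding proj_rel_def by (cases v; cases w) auto
qed

quotient_type f2p1 = "bit \<times> bit" / partial: proj_rel
proof (rule part_equivpI)
  show "\<exists>x. proj_rel x x"
    by (rule exI[of _ "(1, 0)"]) (simp add: proj_rel_iff)
  show "symp proj_rel" "transp proj_rel"
    by (auto simp: symp_def transp_def proj_rel_iff)
qed

lift_definition P_zero :: f2p1 is "(1, 0)"
  by (simp add: proj_rel_iff)

lift_definition P_one :: f2p1 is "(1, 1)"
  by (simp add: proj_rel_iff)

lift_definition P_inf :: f2p1 is "(0, 1)"
  by (simp add: proj_rel_iff)

lemma f2p1_distinct:
  "P_zero \<noteq> P_one" "P_zero \<noteq> P_inf" "P_one \<noteq> P_inf"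
  by (transfer, simp add: proj_rel_iff)+

lemma UNIV_f2p1: "(UNIV :: f2p1 set) = {P_zero, P_one, P_inf}"
proof -
  have "x = P_zero \<or> x = P_one \<or> x = P_inf" for x
  proof (transfer)
    fix x :: "bit \<times> bit"
    assume "proj_rel x x"
    moreover obtain a b where "x = (a, b)"
      by (cases x)
    ultimately show "proj_rel x (1, 0) \<or> proj_rel x (1, 1) \<or> proj_rel x (0, 1)"
      by (cases a; cases b) (auto simp: proj_rel_iff)
  qed
  then show ?thesis by auto
qed

text \<open>The tuple \<open>(y\<^sub>0, \<dots>, y\<^sub>m)\<close> is the list \<open>y\<close> of length \<open>m + 1\<close>.\<close>

definition X_F2 :: "nat \<Rightarrow> f2p1 list set" where
  "X_F2 m = {y. length y = m + 1 \<and> y ! 0 = P_zero \<and> y ! m = P_inf \<and>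
     (\<forall>i<m. y ! i \<noteq> y ! (i + 1))}"

text \<open>
  The segment \<open>ij\<close> joining two distinct vertices is the two-element set \<open>{i, j}\<close>.
  For \<open>m = 1\<close> the polygon degenerates to the single side \<open>{0, 1}\<close>, and its only
  triangulation is the empty set.
\<close>

definition sides :: "nat \<Rightarrow> nat set set" where
  "sides m = {{i, i + 1} | i. i < m} \<union> {{0, m}}"

definition diagonals :: "nat \<Rightarrow> nat set set" where
  "diagonals m = {{i, j} | i j. i \<le> m \<and> j \<le> m \<and> i \<noteq> j} - sides m"

text \<open>
  Two diagonals of a convex polygon cross (that is, meet in an interior point) iff their
  endpoints are distinct and alternate along the boundary.
\<close>

definition crossing :: "nat set \<Rightarrow> nat set \<Rightarrow> bool" where
  "crossing d e \<longleftrightarrow> (\<exists>i j k l. i < j \<and> j < k \<and> k < l \<and>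
     (d = {i, k} \<and> e = {j, l} \<or> d = {j, l} \<and> e = {i, k}))"

definition noncrossing :: "nat \<Rightarrow> nat set set \<Rightarrow> bool" where
  "noncrossing m S \<longleftrightarrow> S \<subseteq> diagonals m \<and> (\<forall>d\<in>S. \<forall>e\<in>S. \<not> crossing d e)"

definition triangulation :: "nat \<Rightarrow> nat set set \<Rightarrow> bool" where
  "triangulation m T \<longleftrightarrow> noncrossing m T \<and>
     (\<forall>S. noncrossing m S \<and> T \<subseteq> S \<longrightarrow> S = T)"

definition coloring :: "nat \<Rightarrow> nat set set \<Rightarrow> f2p1 list" where
  "coloring m T = (THE y. y \<in> X_F2 m \<and>
     (\<forall>i\<le>m. \<forall>j\<le>m. {i, j} \<in> sides m \<union> T \<longrightarrow> y ! i \<noteq> y ! j))"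

text \<open>The vertices are listed clockwise, starting anywhere.\<close>

definition cyclic_order :: "nat list \<Rightarrow> bool" where
  "cyclic_order us \<longleftrightarrow> (\<exists>k. sorted_wrt (<) (rotate k us))"

definition hexagon_in ::
  "nat \<Rightarrow> nat set set \<Rightarrow> nat \<Rightarrow> nat \<Rightarrow> nat \<Rightarrow> nat \<Rightarrow> nat \<Rightarrow> nat \<Rightarrow> bool" where
  "hexagon_in m T u1 u2 u3 u4 u5 u6 \<longleftrightarrow>
     {u1, u2, u3, u4, u5, u6} \<subseteq> {0..m} \<and>
     cyclic_order [u1, u2, u3, u4, u5, u6] \<and>
     {{u1, u2}, {u2, u3}, {u3, u4}, {u4, u5}, {u5, u6}, {u6, u1}} \<subseteq> sides m \<union> T"

definition hexagon_diagonals ::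
  "nat \<Rightarrow> nat \<Rightarrow> nat \<Rightarrow> nat \<Rightarrow> nat \<Rightarrow> nat \<Rightarrow> nat set set" where
  "hexagon_diagonals u1 u2 u3 u4 u5 u6 =
     {{u1, u3}, {u1, u4}, {u1, u5}, {u2, u4}, {u2, u5}, {u2, u6},
      {u3, u5}, {u3, u6}, {u4, u6}}"

definition hexagonal_move :: "nat \<Rightarrow> nat set set \<Rightarrow> nat set set \<Rightarrow> bool" where
  "hexagonal_move m T T' \<longleftrightarrow> (\<exists>u1 u2 u3 u4 u5 u6 A B.
     hexagon_in m T u1 u2 u3 u4 u5 u6 \<and>
     (A = {{u1, u3}, {u3, u6}, {u6, u4}} \<and> B = {{u1, u5}, {u5, u2}, {u2, u4}} \<or>
      A = {{u1, u5}, {u5, u2}, {u2, u4}} \<and> B = {{u1, u3}, {u3, u6}, {u6, u4}} \<or>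
      A = {{u1, u3}, {u3, u5}, {u5, u1}} \<and> B = {{u2, u4}, {u4, u6}, {u6, u2}} \<or>
      A = {{u2, u4}, {u4, u6}, {u6, u2}} \<and> B = {{u1, u3}, {u3, u5}, {u5, u1}}) \<and>
     T \<inter> hexagon_diagonals u1 u2 u3 u4 u5 u6 = A \<and>
     T' = (T - A) \<union> B)"

end

theory Submission
  imports Defs
begin

text \<open>
  Removing an ear (a vertex of degree two) from a triangulation leaves a triangulation of a smaller
  polygon, and every triangulation with at least four vertices has two non-adjacent ears. Hence
  there is exactly one proper 3-colouring with prescribed colours at \<open>0\<close> and \<open>m\<close>, and a hexagonal
  move preserves it because both triangulations of the hexagon force the same colours.

  Conversely let \<open>E\<close> and \<open>E'\<close> be properly coloured by the same \<open>y\<close>; induct on the number of vertices.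
  A common ear can be cut off. Otherwise there are non-adjacent ears \<open>u\<close> of \<open>E\<close> and \<open>v\<close> of \<open>E'\<close>. If the
  other vertices still carry all three colours, they have a triangulation properly coloured by
  \<open>y\<close>; adding both ears to it gives an intermediate triangulation that shares an ear with each of
  \<open>E\<close> and \<open>E'\<close>. If a colour is missing, it occurs only at \<open>u\<close> and \<open>v\<close>, so \<open>E\<close> is the ear at \<open>u\<close> plus the
  fan at \<open>v\<close> and \<open>E'\<close> is the ear at \<open>v\<close> plus the fan at \<open>u\<close>; then a single hexagonal move gives
  \<open>E\<close> an ear of \<open>E'\<close>.
\<close>

section \<open>Cyclic order and maximal noncrossing edge sets\<close>

text \<open>A clockwise walk from \<open>a\<close> meets \<open>b\<close> strictly before
  \<open>c\<close>. Unlike \<open><\<close>, this is invariant under rotation, so no vertex has to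
  be singled out as the first one.\<close>

definition cy :: "nat \<Rightarrow> nat \<Rightarrow> nat \<Rightarrow> bool" where
  "cy a b c \<longleftrightarrow> a < b \<and> b < c \<or> b < c \<and> c < a \<or> c < a \<and> a < b"

definition cross :: "nat \<Rightarrow> nat \<Rightarrow> nat \<Rightarrow> nat \<Rightarrow> bool" where
  "cross a b c d \<longleftrightarrow> cy a c b \<and> cy b d a \<or> cy a d b \<and> cy b c a"

lemma crossing_iff: "crossing {a, b} {c, d} \<longleftrightarrow> cross a b c d"
proof
  assume "crossing {a, b} {c, d}"
  then obtain i j k l where "i < j" "j < k" "k < l"
    "{a, b} = {i, k} \<and> {c, d} = {j, l} \<or> {a, b} = {j, l} \<and> {c, d} = {i, k}"
    unfolding crossing_def by blast
  then show "cross a b c d"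
    unfolding doubleton_eq_iff cross_def cy_def by auto
next
  have *: "crossing {i, k} {j, l}" "crossing {j, l} {i, k}"
    if "i < j" "j < k" "k < l" for i j k l :: nat
    using that unfolding crossing_def by blast+
  assume "cross a b c d"
  then show "crossing {a, b} {c, d}"
    unfolding cross_def cy_def using *
    by (smt (verit) insert_commute not_less_iff_gr_or_eq order.strict_trans)
qed

definition edges :: "nat set \<Rightarrow> nat set set" where
  "edges V = {{i, j} | i j. i \<in> V \<and> j \<in> V \<and> i \<noteq> j}"

text \<open>Here the sides belong to the edge set: no side crosses any edge, so maximality includes them.
  This makes the notion invariant under rotation and meaningful for any vertex set \<open>V\<close>, so that
  ears can be cut off without relabelling. A triangulation \<open>T\<close> corresponds to \<open>T \<union> sides m\<close>.\<close>

definition tri :: "nat set \<Rightarrow> nat set set \<Rightarrow> bool" where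
  "tri V E \<longleftrightarrow> E \<subseteq> edges V \<and> (\<forall>d\<in>E. \<forall>e\<in>E. \<not> crossing d e) \<and>
     (\<forall>d\<in>edges V. (\<forall>e\<in>E. \<not> crossing d e) \<longrightarrow> d \<in> E)"

lemma edges_iff [simp]: "{i, j} \<in> edges V \<longleftrightarrow> i \<in> V \<and> j \<in> V \<and> i \<noteq> j"
  unfolding edges_def by (auto simp: doubleton_eq_iff)

lemma cross_sym: "cross a b c d \<longleftrightarrow> cross c d a b"
  unfolding cross_def cy_def by linarith

lemma triD:
  assumes "tri V E"
  shows "{a, b} \<in> E \<Longrightarrow> a \<in> V" "{a, b} \<in> E \<Longrightarrow> b \<in> V" "{a, b} \<in> E \<Longrightarrow> a \<noteq> b"
    "{a, b} \<in> E \<Longrightarrow> {c, d} \<in> E \<Longrightarrow> \<not> cross a b c d"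
proof -
  show "{a, b} \<in> E \<Longrightarrow> a \<in> V" "{a, b} \<in> E \<Longrightarrow> b \<in> V" "{a, b} \<in> E \<Longrightarrow> a \<noteq> b"
    using assms unfolding tri_def by (metis edges_iff subset_iff)+
  show "{a, b} \<in> E \<Longrightarrow> {c, d} \<in> E \<Longrightarrow> \<not> cross a b c d"
    using assms unfolding tri_def by (metis crossing_iff)
qed

lemma tri_edge:
  assumes "tri V E" "e \<in> E"
  obtains a b where "e = {a, b}" "a \<in> V" "b \<in> V" "a \<noteq> b"
  using assms unfolding tri_def edges_def by blast

lemma tri_memI:
  assumes "tri V E" "a \<in> V" "b \<in> V" "a \<noteq> b"
    "\<And>c d. {c, d} \<in> E \<Longrightarrow> c \<in> V \<Longrightarrow> d \<in> V \<Longrightarrow> \<not> cross a b c d"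
  shows "{a, b} \<in> E"
proof -
  have "\<not> crossing {a, b} e" if "e \<in> E" for e
    using tri_edge[OF assms(1) that] assms(5) that crossing_iff by metis
  then show ?thesis using assms unfolding tri_def by simp
qed

lemma triI:
  assumes "\<And>e. e \<in> E \<Longrightarrow> e \<in> edges V"
    "\<And>a b c d. {a, b} \<in> E \<Longrightarrow> {c, d} \<in> E \<Longrightarrow> \<not> cross a b c d"
    "\<And>a b. a \<in> V \<Longrightarrow> b \<in> V \<Longrightarrow> a \<noteq> b \<Longrightarrow> (\<And>c d. {c, d} \<in> E \<Longrightarrow> \<not> cross a b c d)
      \<Longrightarrow> {a, b} \<in> E"
  shows "tri V E"
proof -
  have 1: "\<exists>a b. e = {a, b} \<and> a \<in> V \<and> b \<in> V \<and> a \<noteq> b" if "e \<in> edges V" for e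
    using that unfolding edges_def by blast
  show ?thesis
    unfolding tri_def
  proof (intro conjI ballI impI subsetI)
    fix d e assume "d \<in> E" "e \<in> E"
    then show "\<not> crossing d e" using 1 assms(1,2) crossing_iff by metis
  next
    fix d assume "d \<in> edges V" "\<forall>e\<in>E. \<not> crossing d e"
    then show "d \<in> E" using 1[of d] assms(3) crossing_iff by metis
  qed (use assms(1) in auto)
qed

text \<open>Sides are directed: \<open>b\<close> is the clockwise successor of \<open>a\<close> in
  \<open>V\<close>. In a set of two vertices both directions are sides.\<close>

definition side :: "nat set \<Rightarrow> nat \<Rightarrow> nat \<Rightarrow> bool" where
  "side V a b \<longleftrightarrow> a \<in> V \<and> b \<in> V \<and> a \<noteq> b \<and> (\<forall>x\<in>V. \<not> cy a x b)"

lemma side_not_cross: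
  assumes "side V a b" "c \<in> V" "d \<in> V"
  shows "\<not> cross a b c d" "\<not> cross b a c d" "\<not> cross c d a b" "\<not> cross c d b a"
proof -
  show "\<not> cross a b c d" "\<not> cross b a c d"
    using assms unfolding side_def cross_def by blast+
  then show "\<not> cross c d a b" "\<not> cross c d b a"
    using cross_sym by blast+
qed

lemma side_in_tri:
  assumes "tri V E" "side V a b"
  shows "{a, b} \<in> E"
  using tri_memI[OF assms(1), of a b] side_not_cross[OF assms(2)] assms(2)
  unfolding side_def by blast

text \<open>Together with \<open>{p, s} \<in> E\<close> this expresses that \<open>E\<close> has an
  ear at \<open>u\<close>; ears appear throughout as this pair of facts.\<close>

definition consecutive :: "nat set \<Rightarrow> nat \<Rightarrow> nat \<Rightarrow> nat \<Rightarrow> bool" where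
  "consecutive V p u s \<longleftrightarrow> p \<in> V \<and> s \<in> V \<and> p \<noteq> s \<and> {x \<in> V. cy p x s} = {u}"

lemma cy_trans: "cy a b c \<Longrightarrow> cy b d c \<Longrightarrow> cy a d c"
  and cy_trans': "cy a b c \<Longrightarrow> cy a d b \<Longrightarrow> cy a d c"
  and cy_trans'': "cy a b c \<Longrightarrow> cy b d c \<Longrightarrow> cy a b d"
  unfolding cy_def by auto
lemma cy_neq: "cy a b c \<Longrightarrow> a \<noteq> b \<and> b \<noteq> c \<and> a \<noteq> c"
  and cy_irrefl [simp]: "\<not> cy a a b" "\<not> cy a b b" "\<not> cy a b a"
  and cy_rot: "cy a b c \<Longrightarrow> cy b c a"
  and cy_asym: "cy a b c \<Longrightarrow> \<not> cy c b a"
  and cy_total: "a \<noteq> b \<Longrightarrow> b \<noteq> c \<Longrightarrow> a \<noteq> c \<Longrightarrow> cy a b c \<or> cy c b a"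
  unfolding cy_def by auto

lemma cy_split: "cy i k j \<Longrightarrow> cy i d j \<Longrightarrow> d = k \<or> cy i d k \<or> cy k d j"
  unfolding cy_def by auto
text \<open>A chord that enters the triangle \<open>i\<close>, \<open>k\<close>, \<open>j\<close>
  through \<open>kj\<close> leaves it through another side or through the vertex \<open>i\<close>.
  The hypotheses exclude the other sides.\<close>

lemma cy_cross_cases:
  assumes "cross k j c d" "\<not> cross i k c d" "\<not> cross i j c d" "cy i k j"
  shows "c = i \<and> cy k d j \<or> d = i \<and> cy k c j"
proof -
  have *: "d = i \<or> cross i k c d \<or> cross i j c d" if c: "cy k c j" and d: "cy j d k" for c d
  proof -
    have "cy j i k" using assms(4) cy_rot by blast
    then consider "d = i" | "cy i d k" | "cy j d i" using cy_split[OF _ d] by blast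
    then show ?thesis
      using c assms(4) unfolding cross_def
      by cases (meson cy_rot cy_trans cy_trans' cy_trans'')+
  qed
  show ?thesis
    using *[of c d] *[of d c] assms unfolding cross_def by blast
qed

section \<open>Arcs: neighbours on the boundary, triangles over an edge, ears\<close>

lemma arc_card_less:
  assumes "finite V" "k \<in> V" "cy i k j"
  shows "card {x \<in> V. cy k x j} < card {x \<in> V. cy i x j}"
    and "card {x \<in> V. cy i x k} < card {x \<in> V. cy i x j}"
proof -
  have "{x \<in> V. cy k x j} \<subseteq> {x \<in> V. cy i x j}" "{x \<in> V. cy i x k} \<subseteq> {x \<in> V. cy i x j}"
    using cy_trans[OF assms(3)] cy_trans'[OF assms(3)] by blast+
  moreover have "k \<in> {x \<in> V. cy i x j}" "k \<notin> {x \<in> V. cy k x j}" "k \<notin> {x \<in> V. cy i x k}"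
    using assms by auto
  ultimately have "{x \<in> V. cy k x j} \<subset> {x \<in> V. cy i x j}" "{x \<in> V. cy i x k} \<subset> {x \<in> V. cy i x j}"
    by blast+
  then show "card {x \<in> V. cy k x j} < card {x \<in> V. cy i x j}"
    "card {x \<in> V. cy i x k} < card {x \<in> V. cy i x j}"
    using assms(1) by (simp_all add: psubset_card_mono)
qed

lemma side_succ:
  assumes "finite V" "i \<in> V" "j \<in> V" "i \<noteq> j"
  obtains u where "side V i u" "u = j \<or> cy i u j"
  using assms(3,4)
proof (induction "card {x \<in> V. cy i x j}" arbitrary: j thesis rule: less_induct)
  case less
  show ?case
  proof (cases "side V i j")
    case False
    then obtain k where k: "k \<in> V" "cy i k j"
      using less.prems assms(2) unfolding side_def by blast
    obtain u where "side V i u" "u = k \<or> cy i u k"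
      using less.hyps[OF arc_card_less(2)[OF assms(1) k]] k cy_neq by metis
    then show ?thesis using less.prems(1) k cy_trans' by metis
  qed (use less.prems in blast)
qed

lemma side_pred:
  assumes "finite V" "i \<in> V" "j \<in> V" "i \<noteq> j"
  obtains u where "side V u j" "u = i \<or> cy i u j"
  using assms(2,4)
proof (induction "card {x \<in> V. cy i x j}" arbitrary: i thesis rule: less_induct)
  case less
  show ?case
  proof (cases "side V i j")
    case False
    then obtain k where k: "k \<in> V" "cy i k j"
      using less.prems assms(3) unfolding side_def by blast
    obtain u where "side V u j" "u = k \<or> cy k u j"
      using less.hyps[OF arc_card_less(1)[OF assms(1) k]] k cy_neq by metis
    then show ?thesis using less.prems(1) k cy_trans by metis
  qed (use less.prems in blast)
qed

text \<open>Start with the successor of \<open>i\<close> and swing the edge at \<open>i\<close>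
  towards \<open>j\<close>. While \<open>{k, j}\<close> is missing, maximality gives an edge
  crossing it; by \<open>cy_cross_cases\<close> that edge starts in \<open>i\<close> and ends
  strictly between \<open>k\<close> and \<open>j\<close>, so the arc from \<open>k\<close> to
  \<open>j\<close> shrinks.\<close>

lemma tri_third_vertex:
  assumes "tri V E" "finite V" "{i, j} \<in> E" "k \<in> V" "cy i k j"
  shows "\<exists>k\<in>V. cy i k j \<and> {i, k} \<in> E \<and> {k, j} \<in> E" (is ?thesis)
proof -
  have *: ?thesis if "k \<in> V" "cy i k j" "{i, k} \<in> E" for k
    using that
  proof (induction "card {x \<in> V. cy k x j}" arbitrary: k rule: less_induct)
    case less
    show ?case
    proof (cases "{k, j} \<in> E")
      case True
      then show ?thesis using less.prems by blast
    next
      case False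
      moreover have "k \<noteq> j" "j \<in> V" using less.prems cy_neq triD(2)[OF assms(1,3)] by auto
      ultimately obtain c d where cd: "{c, d} \<in> E" "cross k j c d"
        using tri_memI[OF assms(1) less.prems(1)] by metis
      then have "c = i \<and> cy k d j \<or> d = i \<and> cy k c j"
        using cy_cross_cases[OF cd(2)] triD(4)[OF assms(1)] less.prems assms(3) by metis
      then obtain x where x: "{i, x} \<in> E" "cy k x j" "x \<in> V"
        using cd(1) triD(1,2)[OF assms(1) cd(1)] by (metis insert_commute)
      show ?thesis
        using less.hyps[OF arc_card_less(1)[OF assms(2) x(3,2)] x(3) _ x(1)]
          cy_trans[OF less.prems(2) x(2)] by blast
    qed
  qed
  obtain u where "side V i u" "u = k \<or> cy i u k"
    using side_succ[OF assms(2), of i k] triD(1)[OF assms(1,3)] assms(4,5) cy_neq by metis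
  then show ?thesis
    using *[of u] side_in_tri[OF assms(1)] assms(5) cy_trans' unfolding side_def by metis
qed

lemma consecutiveD:
  assumes "consecutive V p u s"
  shows "p \<in> V" "s \<in> V" "u \<in> V" "p \<noteq> s" "cy p u s" "\<And>x. x \<in> V \<Longrightarrow> cy p x s \<Longrightarrow> x = u"
    "p \<noteq> u" "u \<noteq> s" "side V p u" "side V u s"
proof -
  show 1: "p \<in> V" "s \<in> V" "u \<in> V" "p \<noteq> s" and 2: "cy p u s"
    and 3: "\<And>x. x \<in> V \<Longrightarrow> cy p x s \<Longrightarrow> x = u"
    using assms unfolding consecutive_def by blast+
  show 4: "p \<noteq> u" "u \<noteq> s" using 2 cy_neq by auto
  show "side V p u" "side V u s"
    using 1 2 3 4 cy_trans cy_trans' unfolding side_def by (metis cy_irrefl)+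
qed

lemma consecutiveI:
  assumes "side V p u" "side V u s" "p \<noteq> s"
  shows "consecutive V p u s"
proof -
  have "cy p u s" using assms cy_total cy_rot unfolding side_def by metis
  moreover have "x = u" if "x \<in> V" "cy p x s" for x
  proof (rule ccontr)
    assume "x \<noteq> u"
    with that(2) \<open>cy p u s\<close> have "cy p x u \<or> cy u x s"
      unfolding cy_def by auto
    then show False using assms that unfolding side_def by auto
  qed
  ultimately show ?thesis
    using assms unfolding consecutive_def side_def by auto
qed

text \<open>The triangle over \<open>ij\<close> has an apex \<open>l\<close> in the arc. If one of
  the two smaller arcs at \<open>l\<close> contains a vertex, recurse over the edge spanning it;
  otherwise \<open>i\<close>, \<open>l\<close>, \<open>j\<close> are consecutive and
  \<open>l\<close> is itself the ear.\<close>

lemma ear_in_arc: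
  assumes "tri V E" "finite V" "{i, j} \<in> E" "k \<in> V" "cy i k j"
  obtains p u s where "cy i u j" "consecutive V p u s" "{p, s} \<in> E"
  using assms(3,4,5)
proof (induction "card {x \<in> V. cy i x j}" arbitrary: i j k thesis rule: less_induct)
  case less
  obtain l where l: "l \<in> V" "cy i l j" "{i, l} \<in> E" "{l, j} \<in> E"
    using tri_third_vertex[OF assms(1,2) less.prems(2-4)] by blast
  show ?case
  proof (cases "\<exists>x\<in>V. cy i x l \<or> cy l x j")
    case True
    then show ?thesis
      using less.hyps[OF arc_card_less(1)[OF assms(2) l(1,2)] _ l(4)]
        less.hyps[OF arc_card_less(2)[OF assms(2) l(1,2)] _ l(3)] less.prems(1)
        cy_trans[OF l(2)] cy_trans'[OF l(2)] by metis
  next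
    case False
    then have "side V i l" "side V l j" "i \<noteq> j"
      using triD[OF assms(1)] l cy_neq unfolding side_def by blast+
    then show ?thesis using consecutiveI less.prems(1,2) l(2) by metis
  qed
qed

lemma edges_DiffI: "e \<in> edges V \<Longrightarrow> u \<notin> e \<Longrightarrow> e \<in> edges (V - {u})"
  unfolding edges_def by auto

lemma edges_mono: "e \<in> edges V \<Longrightarrow> V \<subseteq> W \<Longrightarrow> e \<in> edges W"
  unfolding edges_def by auto

text \<open>This is why an ear has degree two: once \<open>{p, s}\<close> is an edge, it blocks
  every segment from \<open>u\<close> other than the two sides.\<close>

lemma consecutive_cross:
  assumes "consecutive V p u s" "x \<in> V" "x \<noteq> p" "x \<noteq> u" "x \<noteq> s"
  shows "cross u x p s"
proof -
  have "\<not> cy p x s" using consecutiveD(6)[OF assms(1)] assms by blast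
  then have "cy s x p" using cy_total[of p x s] assms(3,5) consecutiveD(4)[OF assms(1)] by blast
  with consecutiveD(5)[OF assms(1)] have "cy u s x" "cy x p u"
    by (meson cy_rot cy_trans'')+
  then show ?thesis unfolding cross_def by blast
qed

section \<open>Ears\<close>

text \<open>By \<open>consecutive_cross\<close> the only edges at \<open>u\<close> are the two
  sides. Sides cross nothing, so deleting them makes no further segment admissible and maximality
  survives.\<close>

lemma remove_ear:
  assumes "tri V E" "consecutive V p u s" "{p, s} \<in> E"
  shows "tri (V - {u}) {e \<in> E. u \<notin> e}" "E = {e \<in> E. u \<notin> e} \<union> {{p, u}, {u, s}}"
proof -
  note nb = consecutiveD[OF assms(2)]
  have sides: "{p, u} \<in> E" "{u, s} \<in> E" using side_in_tri[OF assms(1) nb(9)] side_in_tri[OF assms(1) nb(10)] by auto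
  have *: "e = {p, u} \<or> e = {u, s}" if e: "e \<in> E" "u \<in> e" for e
  proof -
    obtain x where x: "e = {u, x}" "x \<in> V" "x \<noteq> u"
      using tri_edge[OF assms(1) e(1)] e(2) by (metis empty_iff insert_commute insert_iff)
    then show ?thesis
      using consecutive_cross[OF assms(2), of x] triD(4)[OF assms(1) _ assms(3), of u x] e(1)
      by (auto simp: insert_commute)
  qed
  show "E = {e \<in> E. u \<notin> e} \<union> {{p, u}, {u, s}}" using sides * by blast
  show "tri (V - {u}) {e \<in> E. u \<notin> e}"
  proof (rule triI)
    fix e assume "e \<in> {e \<in> E. u \<notin> e}"
    then show "e \<in> edges (V - {u})" using assms(1) edges_DiffI unfolding tri_def by blast
  next
    fix a b c d assume "{a, b} \<in> {e \<in> E. u \<notin> e}" "{c, d} \<in> {e \<in> E. u \<notin> e}"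
    then show "\<not> cross a b c d" using triD(4)[OF assms(1)] by blast
  next
    fix a b assume ab: "a \<in> V - {u}" "b \<in> V - {u}" "a \<noteq> b"
      and nc: "\<And>c d. {c, d} \<in> {e \<in> E. u \<notin> e} \<Longrightarrow> \<not> cross a b c d"
    have "\<not> cross a b c d" if "{c, d} \<in> E" for c d
    proof (cases "u \<in> {c, d}")
      case True
      then have "{c, d} = {p, u} \<or> {c, d} = {u, s}" using * that by blast
      moreover have "\<not> cross a b p u" "\<not> cross a b u s" "\<not> cross a b u p" "\<not> cross a b s u"
        using side_not_cross[OF nb(9), of a b] side_not_cross[OF nb(10), of a b] ab by auto
      ultimately show ?thesis unfolding doubleton_eq_iff by blast
    qed (use nc that in blast)
    then show "{a, b} \<in> {e \<in> E. u \<notin> e}"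
      using tri_memI[OF assms(1), of a b] ab by blast
  qed
qed

lemma side_Diff:
  assumes "consecutive V p u s"
  shows "side (V - {u}) p s"
  using consecutiveD[OF assms] unfolding side_def by blast

text \<open>In the smaller polygon \<open>{p, s}\<close> is a side, hence already in
  \<open>F\<close>. It blocks all segments at \<open>u\<close> except the two sides, which gives
  maximality.\<close>

lemma add_ear:
  assumes "consecutive V p u s" "tri (V - {u}) F"
  shows "tri V (F \<union> {{p, u}, {u, s}})"
proof -
  note nb = consecutiveD[OF assms(1)]
  have ps: "{p, s} \<in> F" using side_in_tri[OF assms(2) side_Diff[OF assms(1)]] .
  have nc: "\<not> cross p u a b" "\<not> cross u s a b" "\<not> cross u p a b" "\<not> cross s u a b"
    "\<not> cross a b p u" "\<not> cross a b u s" "\<not> cross a b u p" "\<not> cross a b s u"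
    if "a \<in> V" "b \<in> V" for a b
    using side_not_cross[OF nb(9) that] side_not_cross[OF nb(10) that] by auto
  have V: "a \<in> V" "b \<in> V" if "{a, b} \<in> F" for a b
    using triD(1,2)[OF assms(2) that] by auto
  show ?thesis
  proof (rule triI)
    fix e assume "e \<in> F \<union> {{p, u}, {u, s}}"
    then show "e \<in> edges V"
      using assms(2) edges_mono[of e "V - {u}" V] nb(1-3,7,8) unfolding tri_def by auto
  next
    fix a b c d
    assume *: "{a, b} \<in> F \<union> {{p, u}, {u, s}}" "{c, d} \<in> F \<union> {{p, u}, {u, s}}"
    then have "a \<in> V" "b \<in> V" "c \<in> V" "d \<in> V" using V nb(1-3) by (auto simp: doubleton_eq_iff)
    with * show "\<not> cross a b c d"
      using nc triD(4)[OF assms(2), of a b c d] by (auto simp: doubleton_eq_iff)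
  next
    fix a b assume ab: "a \<in> V" "b \<in> V" "a \<noteq> b"
      and ncr: "\<And>c d. {c, d} \<in> F \<union> {{p, u}, {u, s}} \<Longrightarrow> \<not> cross a b c d"
    have *: "{u, x} \<in> F \<union> {{p, u}, {u, s}}" if "x \<in> V" "\<not> cross u x p s" "x \<noteq> u" for x
      using consecutive_cross[OF assms(1) that(1)] that by (auto simp: insert_commute)
    have nps: "\<not> cross a b p s" "\<not> cross b a p s"
      using ncr[of p s] ps unfolding cross_def by auto
    consider "a = u" | "b = u" | "u \<noteq> a" "u \<noteq> b" by blast
    then show "{a, b} \<in> F \<union> {{p, u}, {u, s}}"
    proof cases
      case 1
      then show ?thesis using *[of b] ab nps by blast
    next
      case 2
      then show ?thesis using *[of a] ab nps by (metis insert_commute)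
    next
      case 3
      then have "{a, b} \<in> F" using ncr ab by (intro tri_memI[OF assms(2)]) auto
      then show ?thesis by blast
    qed
  qed
qed

section \<open>Proper colourings\<close>

lemma f2p1_cases: "x = P_zero \<or> x = P_one \<or> x = P_inf"
  using UNIV_f2p1 by blast

lemma third_colour:
  fixes a b c d :: f2p1
  shows "\<exists>c. c \<noteq> a \<and> c \<noteq> b"
    and "a \<noteq> b \<Longrightarrow> c \<noteq> a \<Longrightarrow> c \<noteq> b \<Longrightarrow> d \<noteq> a \<Longrightarrow> d \<noteq> b \<Longrightarrow> c = d"
  using f2p1_cases f2p1_distinct by metis+

definition proper :: "(nat \<Rightarrow> f2p1) \<Rightarrow> nat set set \<Rightarrow> bool" where
  "proper y E \<longleftrightarrow> (\<forall>i j. {i, j} \<in> E \<longrightarrow> y i \<noteq> y j)"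

lemma properD: "proper y E \<Longrightarrow> {i, j} \<in> E \<Longrightarrow> y i \<noteq> y j"
  unfolding proper_def by blast

lemma proper_mono: "proper y E \<Longrightarrow> F \<subseteq> E \<Longrightarrow> proper y F"
  unfolding proper_def by blast

lemma proper_insert: "proper y (insert {a, b} E) \<longleftrightarrow> y a \<noteq> y b \<and> proper y E"
  unfolding proper_def by (auto simp: doubleton_eq_iff)

lemma side_Diff_keep: "side V a b \<Longrightarrow> a \<noteq> u \<Longrightarrow> b \<noteq> u \<Longrightarrow> side (V - {u}) a b"
  unfolding side_def by blast

lemma colouring_exists:
  assumes "tri V E" "finite V" "side V b a" "\<alpha> \<noteq> \<beta>"
  shows "\<exists>y. y a = \<alpha> \<and> y b = \<beta> \<and> proper y E"
  using assms(1-3)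
proof (induction "card V" arbitrary: V E rule: less_induct)
  case less
  have ab: "a \<in> V" "b \<in> V" "a \<noteq> b" using less.prems(3) unfolding side_def by auto
  have abE: "{a, b} \<in> E" using side_in_tri[OF less.prems(1,3)] by (simp add: insert_commute)
  show ?case
  proof (cases "\<exists>k\<in>V. cy a k b")
    case True
    then obtain p u s where u: "cy a u b" and nb: "consecutive V p u s" "{p, s} \<in> E"
      using ear_in_arc[OF less.prems(1,2) abE] by blast
    have ne: "u \<noteq> a" "u \<noteq> b" "u \<in> V" using cy_neq[OF u] consecutiveD(3)[OF nb(1)] by auto
    obtain y where y: "y a = \<alpha>" "y b = \<beta>" "proper y {e \<in> E. u \<notin> e}"
      using less.hyps[OF _ remove_ear(1)[OF less.prems(1) nb] finite_Diff[OF less.prems(2)]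
          side_Diff_keep[OF less.prems(3)]] ne card_Diff1_less[OF less.prems(2) ne(3)] by blast
    obtain c where c: "c \<noteq> y p" "c \<noteq> y s" using third_colour(1) by blast
    let ?y = "y(u := c)"
    have "proper ?y {e \<in> E. u \<notin> e}" using y(3) unfolding proper_def by auto
    moreover have "?y p \<noteq> ?y u" "?y u \<noteq> ?y s" using c consecutiveD(7,8)[OF nb(1)] by auto
    ultimately have "proper ?y ({e \<in> E. u \<notin> e} \<union> {{p, u}, {u, s}})"
      by (simp add: proper_insert)
    then have "proper ?y E" using remove_ear(2)[OF less.prems(1) nb] by simp
    moreover have "?y a = \<alpha>" "?y b = \<beta>" using y ne by auto
    ultimately show ?thesis by blast
  next
    case False
    then have "x = a \<or> x = b" if "x \<in> V" for x
      using that less.prems(3) cy_total[of a x b] ab unfolding side_def by blast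
    then have *: "i = a \<and> j = b \<or> i = b \<and> j = a" if "{i, j} \<in> E" for i j
      using triD(1-3)[OF less.prems(1) that] by metis
    have "proper (\<lambda>x. if x = a then \<alpha> else \<beta>) E"
      unfolding proper_def using * assms(4) ab by metis
    then show ?thesis using ab by (intro exI[of _ "\<lambda>x. if x = a then \<alpha> else \<beta>"]) auto
  qed
qed

text \<open>The same induction as for existence: the ear triangle has three pairwise adjacent
  vertices, so the colours of the two neighbours determine that of the ear.\<close>

lemma colouring_unique:
  assumes "tri V E" "finite V" "side V b a" "proper y E" "proper z E" "y a = z a" "y b = z b"
    and "x \<in> V"
  shows "y x = z x"
  using assms(1-5,8)
proof (induction "card V" arbitrary: V E x rule: less_induct)
  case less
  have ab: "a \<in> V" "b \<in> V" "a \<noteq> b" using less.prems(3) unfolding side_def by auto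
  have abE: "{a, b} \<in> E" using side_in_tri[OF less.prems(1,3)] by (simp add: insert_commute)
  show ?case
  proof (cases "\<exists>k\<in>V. cy a k b")
    case True
    then obtain p u s where u: "cy a u b" and nb: "consecutive V p u s" "{p, s} \<in> E"
      using ear_in_arc[OF less.prems(1,2) abE] by blast
    have ne: "u \<noteq> a" "u \<noteq> b" "u \<in> V" using cy_neq[OF u] consecutiveD(3)[OF nb(1)] by auto
    have card: "card (V - {u}) < card V" using card_Diff1_less[OF less.prems(2) ne(3)] .
    have pr: "proper y {e \<in> E. u \<notin> e}" "proper z {e \<in> E. u \<notin> e}"
      using less.prems(4,5) unfolding proper_def by blast+
    have eq: "y x = z x" if "x \<in> V - {u}" for x
      using less.hyps[OF card remove_ear(1)[OF less.prems(1) nb] finite_Diff[OF less.prems(2)]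
          side_Diff_keep[OF less.prems(3)] pr that] ne by blast
    have sides: "{p, u} \<in> E" "{u, s} \<in> E"
      using side_in_tri[OF less.prems(1)] consecutiveD(9,10)[OF nb(1)] by auto
    have "y p = z p" "y s = z s" using eq consecutiveD(1,2,7,8)[OF nb(1)] by auto
    then have "y u = z u"
      using third_colour(2)[of "y p" "y s" "y u" "z u"]
        properD[OF less.prems(4) nb(2)] properD[OF less.prems(4) sides(1)]
        properD[OF less.prems(4) sides(2)] properD[OF less.prems(5) sides(1)]
        properD[OF less.prems(5) sides(2)] by metis
    then show ?thesis using eq less.prems(6) by blast
  next
    case False
    then have "x = a \<or> x = b"
      using less.prems(3,6) cy_total[of a x b] ab unfolding side_def by blast
    then show ?thesis using assms(6,7) by auto
  qed
qed

section \<open>Small vertex sets and the existence of ears\<close>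

lemma cross_distinct: "cross a b c d \<Longrightarrow> card {a, b, c, d} = 4"
  unfolding cross_def cy_def by auto

lemma tri_small:
  assumes "tri V E" "finite V" "card V \<le> 3" "a \<in> V" "b \<in> V" "a \<noteq> b"
  shows "{a, b} \<in> E"
proof (rule tri_memI[OF assms(1,4-6)])
  fix c d assume "c \<in> V" "d \<in> V"
  then have "card {a, b, c, d} \<le> card V" using assms by (intro card_mono) auto
  then show "\<not> cross a b c d" using assms(3) cross_distinct[of a b c d] by linarith
qed

lemma edges_tri:
  assumes "finite V" "card V \<le> 3"
  shows "tri V (edges V)"
proof (rule triI)
  fix a b c d assume *: "{a, b} \<in> edges V" "{c, d} \<in> edges V"
  then have "card {a, b, c, d} \<le> card V" using assms by (intro card_mono) auto
  then show "\<not> cross a b c d" using assms(2) cross_distinct[of a b c d] by linarith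
qed auto

lemma ear_exists:
  assumes "tri V E" "finite V" "card V \<ge> 3"
  obtains p u s where "consecutive V p u s" "{p, s} \<in> E"
proof -
  have ne: "V \<noteq> {}" using assms(3) by auto
  let ?a = "Min V" and ?b = "Max V"
  have ab: "?a \<in> V" "?b \<in> V" "\<And>x. x \<in> V \<Longrightarrow> ?a \<le> x \<and> x \<le> ?b" using ne assms(2) by auto
  have "\<not> V \<subseteq> {?a, ?b}"
  proof
    assume "V \<subseteq> {?a, ?b}"
    then have "card V \<le> card {?a, ?b}" by (intro card_mono) auto
    also have "\<dots> \<le> 2" by (simp add: card_insert_if)
    finally show False using assms(3) by simp
  qed
  then obtain k where k: "k \<in> V" "k \<noteq> ?a" "k \<noteq> ?b" by blast
  then have lt: "?a < k" "k < ?b" using ab(3)[OF k(1)] by auto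
  then have kk: "cy ?a k ?b" unfolding cy_def by simp
  \<comment> \<open>The step from the largest vertex back to the smallest is a side, so the arc on
    the other side of this edge holds every remaining vertex.\<close>
  have "\<not> cy ?b x ?a" if "x \<in> V" for x
    using ab(3)[OF that] lt unfolding cy_def by linarith
  then have "side V ?b ?a" using ab(1,2) lt unfolding side_def by auto
  then have "{?a, ?b} \<in> E" using side_in_tri[OF assms(1)] by (simp add: insert_commute)
  then show thesis using ear_in_arc[OF assms(1,2) _ k(1) kk] that by blast
qed

text \<open>The edge \<open>{p, s}\<close> of a first ear, read from \<open>s\<close> to
  \<open>p\<close>, has the rest of the polygon in its arc. A second ear found strictly inside that
  arc is not adjacent to the first.\<close>

lemma two_ears:
  assumes "tri V E" "finite V" "card V \<ge> 4"
  obtains p u s p' u' s' where "consecutive V p u s" "{p, s} \<in> E" "consecutive V p' u' s'" "{p', s'} \<in> E"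
    "u' \<notin> {p, u, s}"
proof -
  have "card V \<ge> 3" using assms(3) by simp
  then obtain p u s where nb: "consecutive V p u s" "{p, s} \<in> E" using ear_exists assms(1,2) by blast
  have "\<not> V \<subseteq> {p, u, s}"
  proof
    assume "V \<subseteq> {p, u, s}"
    then have "card V \<le> card {p, u, s}" by (intro card_mono) auto
    also have "\<dots> \<le> 3" by (simp add: card_insert_if)
    finally show False using assms(3) by simp
  qed
  then obtain k where k: "k \<in> V" "k \<noteq> p" "k \<noteq> u" "k \<noteq> s" by blast
  then have "cy s k p" using consecutiveD(6)[OF nb(1), of k] consecutiveD(4)[OF nb(1)] cy_total[of p k s] by blast
  moreover have "{s, p} \<in> E" using nb(2) by (simp add: insert_commute)
  ultimately obtain p' u' s' where "cy s u' p" "consecutive V p' u' s'" "{p', s'} \<in> E"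
    using ear_in_arc[OF assms(1,2) _ k(1)] by metis
  moreover from this(1) have "u' \<notin> {p, u, s}"
    using consecutiveD(5)[OF nb(1)] cy_asym cy_neq by blast
  ultimately show thesis using that nb by blast
qed

lemma tri_all_colours:
  assumes "tri V E" "finite V" "card V \<ge> 3" "proper y E"
  shows "\<exists>x\<in>V. y x = c"
proof -
  obtain p u s where nb: "consecutive V p u s" "{p, s} \<in> E" using ear_exists assms(1-3) by blast
  have "{p, u} \<in> E" "{u, s} \<in> E" using side_in_tri[OF assms(1)] consecutiveD(9,10)[OF nb(1)] by auto
  then have "y p \<noteq> y u" "y u \<noteq> y s" "y p \<noteq> y s" using properD[OF assms(4)] nb(2) by auto
  then show ?thesis using third_colour(2)[of "y p" "y s" "y u" c] consecutiveD(1-3)[OF nb(1)] by metis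
qed

text \<open>Every triangle carries all three colours, hence has \<open>v\<close> as a vertex. The
  induction cuts off an ear other than \<open>v\<close>, which exists because there are two;
  \<open>v\<close> must then be one of its two neighbours.\<close>

lemma fan_at_unique_colour:
  assumes "tri V E" "finite V" "proper y E" "v \<in> V" "\<And>x. x \<in> V \<Longrightarrow> x \<noteq> v \<Longrightarrow> y x \<noteq> y v"
    and "w \<in> V" "w \<noteq> v"
  shows "{v, w} \<in> E"
  using assms
proof (induction "card V" arbitrary: V E w rule: less_induct)
  case less
  show ?case
  proof (cases "card V \<le> 3")
    case True
    then show ?thesis using tri_small less.prems by metis
  next
    case False
    then have "card V \<ge> 4" by simp
    then obtain p u s where nb: "consecutive V p u s" "{p, s} \<in> E" "u \<noteq> v"
      using two_ears[OF less.prems(1,2)] by (metis insertCI)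
    note nbd = consecutiveD[OF nb(1)]
    show ?thesis
    proof (cases "w = u")
      case True
      have sides: "{p, u} \<in> E" "{u, s} \<in> E" using side_in_tri[OF less.prems(1)] nbd(9,10) by auto
      then have "y p \<noteq> y u" "y u \<noteq> y s" "y p \<noteq> y s" using properD[OF less.prems(3)] nb(2) by auto
      then have "y p = y v \<or> y s = y v \<or> y u = y v" using third_colour(2)[of "y p" "y s" "y u" "y v"] by metis
      then have "p = v \<or> s = v" using less.prems(5) nbd(1-3) nb(3) by blast
      then show ?thesis using sides True by (auto simp: insert_commute)
    next
      case False
      have "card (V - {u}) < card V" using card_Diff1_less[OF less.prems(2) nbd(3)] .
      moreover have "proper y {e \<in> E. u \<notin> e}" by (rule proper_mono[OF less.prems(3)]) blast
      ultimately have "{v, w} \<in> {e \<in> E. u \<notin> e}"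
        using less.prems(5-7) nb(3) False
        by (intro less.hyps[OF _ remove_ear(1)[OF less.prems(1) nb(1,2)]
              finite_Diff[OF less.prems(2)]]) (use less.prems(4) in auto)
      then show ?thesis by simp
    qed
  qed
qed

section \<open>Triangulations compatible with a given colouring\<close>

lemma side_Diff_cases:
  assumes "consecutive V p u s" "side (V - {u}) a b"
  shows "side V a b \<or> a = p \<and> b = s"
proof (rule disjCI)
  assume ne: "\<not> (a = p \<and> b = s)"
  note nb = consecutiveD[OF assms(1)]
  have ab: "a \<in> V" "b \<in> V" "a \<noteq> b" "a \<noteq> u" "b \<noteq> u" and nc: "\<And>x. x \<in> V \<Longrightarrow> x \<noteq> u \<Longrightarrow> \<not> cy a x b"
    using assms(2) unfolding side_def by auto
  have "\<not> cy a u b"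
  proof
    assume u: "cy a u b"
    have "a = p"
    proof (rule ccontr)
      assume "a \<noteq> p"
      then have "b = p \<or> cy b p a"
        using nc[OF nb(1)] nb(7) ab(3) cy_total[of a p b] by blast
      then have "cy p a u"
      proof
        assume "b = p"
        then show ?thesis using u cy_rot by blast
      next
        assume "cy b p a"
        then have "cy p a b" using cy_rot by blast
        then show ?thesis using u cy_rot cy_trans'' by blast
      qed
      then show False using nb(5) nb(6)[of a] ab(1,4) cy_trans' by blast
    qed
    moreover have "b = s"
    proof (rule ccontr)
      assume "b \<noteq> s"
      then have "a = s \<or> cy b s a"
        using nc[OF nb(2)] nb(8) ab(3) cy_total[of a s b] by blast
      then have "cy u b s"
      proof
        assume "a = s"
        then show ?thesis using u cy_rot by blast
      next
        assume "cy b s a"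
        then have "cy a b s" using cy_rot by blast
        then show ?thesis using u by (meson cy_rot cy_trans'')
      qed
      then show False using nb(5) nb(6)[of b] ab(2,5) cy_trans by blast
    qed
    ultimately show False using ne by blast
  qed
  then show "side V a b" using ab nc unfolding side_def by blast
qed

lemma rainbow_triple:
  assumes "finite W" "\<And>a b. side W a b \<Longrightarrow> y a \<noteq> y b"
    and "i \<in> W" "j \<in> W" "\<And>c. \<exists>x\<in>W. (x = i \<or> x = j \<or> cy i x j) \<and> y x = c"
  shows "\<exists>p u s. consecutive W p u s \<and> y p \<noteq> (y s :: f2p1)"
  using assms(3-5)
proof (induction "card {x \<in> W. cy i x j}" arbitrary: i j rule: less_induct)
  case less
  have out: "\<exists>x\<in>W. cy i x j \<and> y x \<noteq> y i \<and> y x \<noteq> y j"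
  proof -
    obtain c where "c \<noteq> y i" "c \<noteq> y j" using third_colour(1) by blast
    then show ?thesis using less.prems(3)[of c] by blast
  qed
  then obtain z where z: "z \<in> W" "cy i z j" by blast
  obtain u where u: "side W i u" "u = z \<or> cy i u z"
    using side_succ[OF assms(1) less.prems(1) z(1)] cy_neq[OF z(2)] by blast
  obtain w where w: "side W w j" "w = z \<or> cy z w j"
    using side_pred[OF assms(1) z(1) less.prems(2)] cy_neq[OF z(2)] by blast
  have iu: "cy i u j" "u \<in> W" and iw: "cy i w j" "w \<in> W"
    using u w cy_trans[OF z(2)] cy_trans'[OF z(2)] z(2) unfolding side_def by auto
  show ?case
  proof (cases "(\<forall>c. \<exists>x\<in>W. (x = u \<or> x = j \<or> cy u x j) \<and> y x = c) \<or>
      (\<forall>c. \<exists>x\<in>W. (x = i \<or> x = w \<or> cy i x w) \<and> y x = c)")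
    case True
    then show ?thesis
      using less.hyps[OF arc_card_less(1)[OF assms(1) iu(2,1)] iu(2) less.prems(2)]
        less.hyps[OF arc_card_less(2)[OF assms(1) iw(2,1)] less.prems(1) iw(2)] by blast
  next
    case False
    \<comment> \<open>Dropping \<open>i\<close> loses some colour \<open>c\<close>, which can only
      be that of \<open>i\<close>; hence this colour does not recur on the arc.\<close>
    have yi: "y x \<noteq> y i" if "x \<in> W" "x = j \<or> cy i x j" for x
    proof -
      obtain c where c: "\<And>x. x \<in> W \<Longrightarrow> x = u \<or> x = j \<or> cy u x j \<Longrightarrow> y x \<noteq> c"
        using False by blast
      have *: "x = u \<or> x = j \<or> cy u x j" if "x \<in> W" "x = j \<or> cy i x j" for x
        using that cy_split[OF iu(1), of x] u(1) unfolding side_def by blast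
      then have "y i = c" using less.prems(3)[of c] c by blast
      then show ?thesis using c * that by blast
    qed
    have yj: "y x \<noteq> y j" if "x \<in> W" "x = i \<or> cy i x j" for x
    proof -
      obtain c where c: "\<And>x. x \<in> W \<Longrightarrow> x = i \<or> x = w \<or> cy i x w \<Longrightarrow> y x \<noteq> c"
        using False by blast
      have *: "x = i \<or> x = w \<or> cy i x w" if "x \<in> W" "x = i \<or> cy i x j" for x
        using that cy_split[OF iw(1), of x] w(1) unfolding side_def by blast
      then have "y j = c" using less.prems(3)[of c] c by blast
      then show ?thesis using c * that by blast
    qed
    have ij: "y i \<noteq> y j" using yj[OF less.prems(1)] by blast
    obtain s where s: "side W u s" "s = j \<or> cy u s j"
      using side_succ[OF assms(1) iu(2) less.prems(2)] cy_neq[OF iu(1)] by blast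
    have "s = j"
    proof (rule ccontr)
      assume "s \<noteq> j"
      then have "cy i s j" "s \<in> W" using s iu(1) cy_trans unfolding side_def by blast+
      then have "y s = y u"
        using third_colour(2)[OF ij] yi yj iu by blast
      then show False using assms(2)[OF s(1)] by simp
    qed
    then show ?thesis using consecutiveI[OF u(1)] s(1) ij by metis
  qed
qed

text \<open>If the colour of the middle vertex of a rainbow triple \<open>(p, u, s)\<close> is unique, the
  triple centred at \<open>p\<close> is again rainbow, and the colour of \<open>p\<close> recurs behind \<open>s\<close>.\<close>

lemma removable_vertex:
  assumes "finite W" "card W \<ge> 4" "\<And>a b. side W a b \<Longrightarrow> y a \<noteq> (y b :: f2p1)"
    and "\<And>c. \<exists>x\<in>W. y x = c"
  shows "\<exists>p u s x. consecutive W p u s \<and> y p \<noteq> y s \<and> x \<in> W \<and> x \<noteq> u \<and> y x = y u"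
proof -
  have W: "W \<noteq> {}" using assms(2) by auto
  define i j where "i = Min W" and "j = Max W"
  have ij: "i \<in> W" "j \<in> W" "\<And>x. x \<in> W \<Longrightarrow> i \<le> x \<and> x \<le> j"
    using W assms(1) unfolding i_def j_def by auto
  \<comment> \<open>Cutting the circle between the largest and the smallest vertex makes all of
    \<open>W\<close> a single arc, as \<open>rainbow_triple\<close> requires.\<close>
  have "x = i \<or> x = j \<or> cy i x j" if "x \<in> W" for x
    using ij(3)[OF that] unfolding cy_def by linarith
  then have "\<exists>x\<in>W. (x = i \<or> x = j \<or> cy i x j) \<and> y x = c" for c
    using assms(4)[of c] by blast
  then obtain p u s where nb: "consecutive W p u s" and ps: "y p \<noteq> y s"
    using rainbow_triple[of W y i j, OF assms(1,3) ij(1,2)] by blast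
  note nbd = consecutiveD[OF nb]
  show ?thesis
  proof (cases "\<exists>x\<in>W. x \<noteq> u \<and> y x = y u")
    case True
    then show ?thesis using nb ps by blast
  next
    case False
    obtain q where q: "side W q p" using side_pred[OF assms(1) nbd(2,1)] nbd(4) by metis
    obtain t where t: "side W s t" using side_succ[OF assms(1) nbd(2,1)] nbd(4) by metis
    have "q \<noteq> u" using q nbd(2,5) cy_rot unfolding side_def by blast
    then have q': "consecutive W q p u" using consecutiveI[OF q nbd(9)] by blast
    have "t \<noteq> u" using t nbd(1,5) cy_rot unfolding side_def by blast
    \<comment> \<open>\<open>t\<close> is to be the second vertex with the colour of
      \<open>p\<close>. If it were \<open>p\<close> itself, \<open>W\<close> would have only three
      vertices.\<close>
    have "t \<noteq> p"
    proof
      assume "t = p"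
      then have "x \<in> {p, u, s}" if "x \<in> W" for x
        using that t nbd(4) nbd(6)[OF that] cy_total[of p x s] unfolding side_def by blast
      then have "card W \<le> card {p, u, s}" by (intro card_mono) auto
      also have "\<dots> \<le> 3" by (simp add: card_insert_if)
      finally show False using assms(2) by simp
    qed
    have "y t \<noteq> y u" "y q \<noteq> y u" using False \<open>t \<noteq> u\<close> \<open>q \<noteq> u\<close> t q unfolding side_def by auto
    moreover have "y t = y p"
      using third_colour(2)[of "y u" "y s" "y t" "y p"] \<open>y t \<noteq> y u\<close> ps assms(3)[OF t]
        assms(3)[OF nbd(10)] assms(3)[OF nbd(9)] by metis
    ultimately show ?thesis using q' \<open>t \<noteq> p\<close> t unfolding side_def by blast
  qed
qed

text \<open>Cut off the vertex from \<open>removable_vertex\<close> and glue it back as an ear: the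
  only new side is \<open>ps\<close>, whose ends differ in colour, and the colour of
  \<open>u\<close> survives at \<open>x\<close>. With at most three vertices the colouring is
  injective, so all segments may be taken.\<close>

lemma rainbow_tri_exists:
  assumes "finite W" "\<And>a b. side W a b \<Longrightarrow> y a \<noteq> (y b :: f2p1)" "\<And>c. \<exists>x\<in>W. y x = c"
  shows "\<exists>F. tri W F \<and> proper y F"
  using assms
proof (induction "card W" arbitrary: W rule: less_induct)
  case less
  have UNIV: "y ` W = UNIV" using less.prems(3) by (auto simp: image_iff) metis
  have card3: "card (UNIV :: f2p1 set) = 3"
    using f2p1_distinct unfolding UNIV_f2p1 by simp
  show ?case
  proof (cases "card W \<le> 3")
    case True
    then have "card W = card (y ` W)"
      using card_image_le[OF less.prems(1), of y] UNIV card3 by simp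
    then have "inj_on y W" using eq_card_imp_inj_on[OF less.prems(1)] by metis
    then have "proper y (edges W)" unfolding proper_def inj_on_def by auto
    then show ?thesis using edges_tri[OF less.prems(1) True] by blast
  next
    case False
    then have "card W \<ge> 4" by simp
    then obtain p u s x where nb: "consecutive W p u s" and ps: "y p \<noteq> y s"
      and x: "x \<in> W" "x \<noteq> u" "y x = y u"
      using removable_vertex[OF less.prems(1)] less.prems(2,3) by metis
    have "\<exists>F. tri (W - {u}) F \<and> proper y F"
    proof (rule less.hyps)
      show "card (W - {u}) < card W" using card_Diff1_less[OF less.prems(1) consecutiveD(3)[OF nb]] .
      show "finite (W - {u})" using less.prems(1) by simp
      show "y a \<noteq> y b" if "side (W - {u}) a b" for a b
        using side_Diff_cases[OF nb that] ps less.prems(2) by blast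
      show "\<exists>x\<in>W - {u}. y x = c" for c
        using less.prems(3)[of c] x by (metis DiffI singletonD)
    qed
    then obtain F where F: "tri (W - {u}) F" "proper y F" by blast
    have "proper y (F \<union> {{p, u}, {u, s}})"
      using F(2) less.prems(2) consecutiveD(9,10)[OF nb] by (simp add: proper_insert)
    then show ?thesis using add_ear[OF nb F(1)] by blast
  qed
qed

section \<open>Hexagonal moves\<close>

text \<open>The neighbours \<open>a\<close> and \<open>b\<close> of \<open>x\<close> among the
  vertices of \<open>H\<close> form a side of \<open>H\<close>. Since \<open>xz\<close> does not
  cross it, \<open>z\<close> stays within the closed arc from \<open>a\<close> to \<open>b\<close>,
  and no vertex of \<open>H\<close> lies strictly inside that arc.\<close>

lemma not_cross_polygon:
  assumes "finite H" "x \<notin> H" "c \<in> H" "d \<in> H" "c \<noteq> d"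
    and "\<And>a b. side H a b \<Longrightarrow> \<not> cross x z a b"
  shows "\<not> cross x z c d"
proof -
  let ?H = "insert x H"
  have fin: "finite ?H" using assms(1) by simp
  obtain b where b: "side ?H x b" "b = c \<or> cy x b c"
    using side_succ[OF fin, of x c] assms(2,3) by blast
  obtain a where a: "side ?H a x" "a = c \<or> cy c a x"
    using side_pred[OF fin, of c x] assms(2,3) by blast
  have H: "a \<in> H" "b \<in> H" using a b unfolding side_def by auto
  \<comment> \<open>If the two neighbours coincided, \<open>H\<close> would be a single point,
    against \<open>c \<noteq> d\<close>.\<close>
  have "a \<noteq> b"
  proof
    assume "a = b"
    have "d \<noteq> x" using assms(2,4) by blast
    have nd: "\<not> cy x d b" "\<not> cy b d x" "\<not> cy x c b" "\<not> cy b c x"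
      using a(1) b(1) \<open>a = b\<close> assms(3,4) unfolding side_def by auto
    have "d = b" "c = b"
      using nd cy_total[of x d b] cy_total[of x c b] assms(2,3,4) H cy_rot by metis+
    then show False using assms(5) by simp
  qed
  have nax: "\<not> cy a h x" and nxb: "\<not> cy x h b" if "h \<in> H" for h
    using a(1) b(1) that unfolding side_def by auto
  have "x \<noteq> a" "x \<noteq> b" using H assms(2) by auto
  then have axb: "cy a x b"
    using cy_total[of a x b] \<open>a \<noteq> b\<close> nxb[OF H(1)] cy_rot by blast
  have nab: "\<not> cy a h b" if "h \<in> H" for h
    using cy_split[OF axb, of h] nax[OF that] nxb[OF that] that assms(2) by blast
  then have "side H a b" using H \<open>a \<noteq> b\<close> unfolding side_def by blast
  then have "\<not> cross x z a b" using assms(6) by blast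
  moreover have "cross x z a b" if "cy b z a"
    using that axb cy_trans''[of x b a z] cy_trans''[of z a b x] cy_rot unfolding cross_def by blast
  ultimately have z: "z = a \<or> z = b \<or> cy a z b"
    using cy_total[of a z b] \<open>a \<noteq> b\<close> by blast
  have "\<not> cy x h z \<or> \<not> cy z k x" if "h \<in> H" "k \<in> H" for h k
  proof -
    consider "z = a" | "z = b" | "cy a z b" "z = x" | "cy a z x" | "cy x z b"
      using z cy_split[OF axb] by blast
    then show ?thesis
    proof cases
      case 4
      then have "\<not> cy z k x" using cy_trans nax[OF that(2)] by blast
      then show ?thesis by blast
    next
      case 5
      then have "\<not> cy x h z" using cy_trans' nxb[OF that(1)] by blast
      then show ?thesis by blast
    qed (use nax nxb that in auto)
  qed
  then show ?thesis using assms(3,4) unfolding cross_def by blast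
qed

lemma cross_swap: "cross a b c d \<longleftrightarrow> cross b a c d"
  unfolding cross_def by blast

text \<open>A segment with an end outside \<open>H\<close> that crosses no side of \<open>H\<close>
  crosses no chord of \<open>H\<close>, so the inside of \<open>H\<close> can be exchanged
  independently of the rest. This serves both for noncrossing of old and new edges and for
  maximality.\<close>

lemma retriangulate:
  assumes "tri V E" "finite V" "H \<subseteq> V" "\<And>a b. side H a b \<Longrightarrow> {a, b} \<in> E" "tri H G"
  shows "tri V ((E - edges H) \<union> G)"
proof -
  have fin: "finite H" using assms(2,3) finite_subset by blast
  have key: "\<not> cross x z c d"
    if "{x, z} \<notin> edges H" "x \<noteq> z" "{c, d} \<in> edges H" "\<And>a b. side H a b \<Longrightarrow> \<not> cross x z a b"
    for x z c d
  proof (cases "x \<in> H")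
    case False
    then show ?thesis using not_cross_polygon[OF fin False, of c d z] that by simp
  next
    case True
    then have "z \<notin> H" using that by simp
    then show ?thesis using not_cross_polygon[OF fin, of z c d x] that cross_swap
      by (metis edges_iff)
  qed
  have GH: "e \<in> edges H" if "e \<in> G" for e using assms(5) that unfolding tri_def by blast
  have EG: "\<not> cross a b c d" if "{a, b} \<in> E - edges H" "{c, d} \<in> G" for a b c d
    using key[of a b c d] that GH triD(3,4)[OF assms(1), of a b] assms(4) by blast
  show ?thesis
  proof (rule triI)
    fix e assume "e \<in> (E - edges H) \<union> G"
    then show "e \<in> edges V"
      using GH edges_mono[OF _ assms(3)] assms(1) unfolding tri_def by blast
  next
    fix a b c d assume "{a, b} \<in> (E - edges H) \<union> G" "{c, d} \<in> (E - edges H) \<union> G"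
    then show "\<not> cross a b c d"
      using EG triD(4)[OF assms(1), of a b c d] triD(4)[OF assms(5), of a b c d]
        cross_sym[of a b c d] by blast
  next
    fix a b assume ab: "a \<in> V" "b \<in> V" "a \<noteq> b"
      and nc: "\<And>c d. {c, d} \<in> (E - edges H) \<union> G \<Longrightarrow> \<not> cross a b c d"
    show "{a, b} \<in> (E - edges H) \<union> G"
    proof (cases "{a, b} \<in> edges H")
      case True
      then show ?thesis using tri_memI[OF assms(5), of a b] nc by simp
    next
      case False
      have "\<not> cross a b c d" if "{c, d} \<in> edges H" for c d
        using key[OF False ab(3) that] nc side_in_tri[OF assms(5)] by blast
      then have "{a, b} \<in> E" using tri_memI[OF assms(1) ab] nc by blast
      then show ?thesis using False by blast
    qed
  qed
qed

section \<open>The hexagon: cyclic order, edges and four of its triangulations\<close>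

lemma cyclic_order_rotations:
  assumes "cyclic_order [u1, u2, u3, u4, u5, u6]"
  shows "u1 < u2 \<and> u2 < u3 \<and> u3 < u4 \<and> u4 < u5 \<and> u5 < u6 \<or>
     u2 < u3 \<and> u3 < u4 \<and> u4 < u5 \<and> u5 < u6 \<and> u6 < u1 \<or>
     u3 < u4 \<and> u4 < u5 \<and> u5 < u6 \<and> u6 < u1 \<and> u1 < u2 \<or>
     u4 < u5 \<and> u5 < u6 \<and> u6 < u1 \<and> u1 < u2 \<and> u2 < u3 \<or>
     u5 < u6 \<and> u6 < u1 \<and> u1 < u2 \<and> u2 < u3 \<and> u3 < u4 \<or>
     u6 < u1 \<and> u1 < u2 \<and> u2 < u3 \<and> u3 < u4 \<and> u4 < u5"
proof -
  let ?us = "[u1, u2, u3, u4, u5, u6]"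
  obtain k where "sorted_wrt (<) (rotate k ?us)" using assms unfolding cyclic_order_def by blast
  then have "sorted_wrt (<) (rotate (k mod 6) ?us)" using rotate_conv_mod[of k ?us] by simp
  moreover have "k mod 6 = 0 \<or> k mod 6 = 1 \<or> k mod 6 = 2 \<or> k mod 6 = 3 \<or> k mod 6 = 4 \<or> k mod 6 = 5"
    by linarith
  ultimately have "sorted_wrt (<) (rotate 0 ?us) \<or> sorted_wrt (<) (rotate 1 ?us) \<or>
      sorted_wrt (<) (rotate 2 ?us) \<or> sorted_wrt (<) (rotate 3 ?us) \<or>
      sorted_wrt (<) (rotate 4 ?us) \<or> sorted_wrt (<) (rotate 5 ?us)"
    by metis
  then show ?thesis
    by (elim disjE) (simp_all add: numeral_eq_Suc)
qed

text \<open>Cutting the circle at \<open>u1\<close> lists the other five vertices linearly, so these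
  four triples already fix the whole order.\<close>

lemma cyclic_order_hexagonI:
  assumes "cy u1 u2 u3" "cy u1 u3 u4" "cy u1 u4 u5" "cy u1 u5 u6"
  shows "cyclic_order [u1, u2, u3, u4, u5, u6]"
proof -
  have "u1 < u2 \<and> u2 < u3 \<and> u3 < u4 \<and> u4 < u5 \<and> u5 < u6 \<or>
     u2 < u3 \<and> u3 < u4 \<and> u4 < u5 \<and> u5 < u6 \<and> u6 < u1 \<or>
     u3 < u4 \<and> u4 < u5 \<and> u5 < u6 \<and> u6 < u1 \<and> u1 < u2 \<or>
     u4 < u5 \<and> u5 < u6 \<and> u6 < u1 \<and> u1 < u2 \<and> u2 < u3 \<or>
     u5 < u6 \<and> u6 < u1 \<and> u1 < u2 \<and> u2 < u3 \<and> u3 < u4 \<or>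
     u6 < u1 \<and> u1 < u2 \<and> u2 < u3 \<and> u3 < u4 \<and> u4 < u5"
    using assms unfolding cy_def by (elim disjE conjE) simp_all
  moreover have "sorted_wrt (<) (rotate k [u1, u2, u3, u4, u5, u6]) \<Longrightarrow> ?thesis" for k
    unfolding cyclic_order_def by blast
  note this[of 0] this[of 1] this[of 2] this[of 3] this[of 4] this[of 5]
  ultimately show ?thesis by (elim disjE) (simp_all add: numeral_eq_Suc)
qed

lemma hexagon_cy:
  assumes "cyclic_order [u1, u2, u3, u4, u5, u6]"
  shows "cy u1 u2 u3" "cy u1 u2 u4" "cy u1 u2 u5" "cy u1 u2 u6" "cy u1 u3 u4"
    "cy u1 u3 u5" "cy u1 u3 u6" "cy u1 u4 u5" "cy u1 u4 u6" "cy u1 u5 u6"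
    "cy u2 u3 u4" "cy u2 u3 u5" "cy u2 u3 u6" "cy u2 u4 u5" "cy u2 u4 u6"
    "cy u2 u5 u6" "cy u3 u4 u5" "cy u3 u4 u6" "cy u3 u5 u6" "cy u4 u5 u6"
  using cyclic_order_rotations[OF assms] unfolding cy_def by (elim disjE; simp)+

definition hexagon_sides ::
  "nat \<Rightarrow> nat \<Rightarrow> nat \<Rightarrow> nat \<Rightarrow> nat \<Rightarrow> nat \<Rightarrow> nat set set" where
  "hexagon_sides u1 u2 u3 u4 u5 u6 = {{u1, u2}, {u2, u3}, {u3, u4}, {u4, u5}, {u5, u6}, {u6, u1}}"

definition hexagon_swap ::
  "nat \<Rightarrow> nat \<Rightarrow> nat \<Rightarrow> nat \<Rightarrow> nat \<Rightarrow> nat \<Rightarrow> nat set set \<Rightarrow> nat set set \<Rightarrow> bool" where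
  "hexagon_swap u1 u2 u3 u4 u5 u6 A B \<longleftrightarrow>
      A = {{u1, u3}, {u3, u6}, {u6, u4}} \<and> B = {{u1, u5}, {u5, u2}, {u2, u4}} \<or>
      A = {{u1, u5}, {u5, u2}, {u2, u4}} \<and> B = {{u1, u3}, {u3, u6}, {u6, u4}} \<or>
      A = {{u1, u3}, {u3, u5}, {u5, u1}} \<and> B = {{u2, u4}, {u4, u6}, {u6, u2}} \<or>
      A = {{u2, u4}, {u4, u6}, {u6, u2}} \<and> B = {{u1, u3}, {u3, u5}, {u5, u1}}"

lemma hexagon_distinct:
  assumes "cyclic_order [u1, u2, u3, u4, u5, u6]"
  shows "distinct [u1, u2, u3, u4, u5, u6]"
  using cyclic_order_rotations[OF assms] by auto

lemma edges_hexagon: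
  assumes "cyclic_order [u1, u2, u3, u4, u5, u6]"
  shows "edges {u1, u2, u3, u4, u5, u6} =
      hexagon_sides u1 u2 u3 u4 u5 u6 \<union> hexagon_diagonals u1 u2 u3 u4 u5 u6"
    and "hexagon_sides u1 u2 u3 u4 u5 u6 \<inter> hexagon_diagonals u1 u2 u3 u4 u5 u6 = {}"
proof -
  note d = hexagon_distinct[OF assms, simplified]
  have "e \<in> hexagon_sides u1 u2 u3 u4 u5 u6 \<union> hexagon_diagonals u1 u2 u3 u4 u5 u6"
    if e: "e \<in> edges {u1, u2, u3, u4, u5, u6}" for e
  proof -
    obtain i j where ij: "e = {i, j}" "i \<noteq> j"
      and "i \<in> {u1, u2, u3, u4, u5, u6}" "j \<in> {u1, u2, u3, u4, u5, u6}"
      using e unfolding edges_def by blast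
    then show ?thesis
      unfolding hexagon_sides_def hexagon_diagonals_def insert_iff empty_iff
      by (elim disjE FalseE) (simp_all add: doubleton_eq_iff)
  qed
  moreover have "hexagon_sides u1 u2 u3 u4 u5 u6 \<subseteq> edges {u1, u2, u3, u4, u5, u6}"
    unfolding hexagon_sides_def using d by (elim conjE) simp
  moreover have "hexagon_diagonals u1 u2 u3 u4 u5 u6 \<subseteq> edges {u1, u2, u3, u4, u5, u6}"
    unfolding hexagon_diagonals_def using d by (elim conjE) simp
  ultimately show "edges {u1, u2, u3, u4, u5, u6} =
      hexagon_sides u1 u2 u3 u4 u5 u6 \<union> hexagon_diagonals u1 u2 u3 u4 u5 u6"
    by blast
  show "hexagon_sides u1 u2 u3 u4 u5 u6 \<inter> hexagon_diagonals u1 u2 u3 u4 u5 u6 = {}"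
    unfolding hexagon_sides_def hexagon_diagonals_def using d
    by (elim conjE) (simp add: doubleton_eq_iff)
qed

lemma side_hexagon:
  assumes "cyclic_order [u1, u2, u3, u4, u5, u6]" "side {u1, u2, u3, u4, u5, u6} a b"
  shows "{a, b} \<in> hexagon_sides u1 u2 u3 u4 u5 u6"
proof -
  note c = hexagon_cy[OF assms(1)]
  note c' = c c[THEN cy_rot] c[THEN cy_rot, THEN cy_rot]
  have "a \<in> {u1, u2, u3, u4, u5, u6}" "b \<in> {u1, u2, u3, u4, u5, u6}" "a \<noteq> b"
    and n: "\<not> cy a u1 b" "\<not> cy a u2 b" "\<not> cy a u3 b" "\<not> cy a u4 b" "\<not> cy a u5 b" "\<not> cy a u6 b"
    using assms(2) unfolding side_def by blast+
  then show ?thesis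
    unfolding hexagon_sides_def insert_iff empty_iff
    by (elim disjE FalseE) (simp_all add: doubleton_eq_iff c')
qed

lemma tri_triangle:
  assumes "a \<noteq> b" "b \<noteq> c" "c \<noteq> a"
  shows "tri {a, b, c} {{a, b}, {b, c}, {c, a}}"
proof -
  have "e \<in> {{a, b}, {b, c}, {c, a}}" if e: "e \<in> edges {a, b, c}" for e
  proof -
    obtain i j where "e = {i, j}" "i \<noteq> j" "i \<in> {a, b, c}" "j \<in> {a, b, c}"
      using e unfolding edges_def by blast
    then show ?thesis
      unfolding insert_iff empty_iff by (elim disjE FalseE) (simp_all add: doubleton_eq_iff)
  qed
  moreover have "{{a, b}, {b, c}, {c, a}} \<subseteq> edges {a, b, c}" using assms by simp
  ultimately have "edges {a, b, c} = {{a, b}, {b, c}, {c, a}}" by blast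
  moreover have "card {a, b, c} \<le> 3" by (simp add: card_insert_if)
  ultimately show ?thesis using edges_tri[of "{a, b, c}"] by simp
qed

lemma add_ear_insert:
  assumes "tri W F" "p \<in> W" "s \<in> W" "cy p u s" "\<forall>x\<in>W. \<not> cy p x s"
  shows "tri (insert u W) (F \<union> {{p, u}, {u, s}})"
proof -
  have "u \<notin> W" using assms by blast
  moreover have "consecutive (insert u W) p u s"
    using assms cy_neq[OF assms(4)] unfolding consecutive_def by auto
  ultimately show ?thesis using add_ear[of "insert u W" p u s F] assms(1) by simp
qed

context
  fixes u1 u2 u3 u4 u5 u6 :: nat
  assumes cyc: "cyclic_order [u1, u2, u3, u4, u5, u6]"
begin

lemmas cyc_facts = hexagon_cy[OF cyc] hexagon_cy[OF cyc, THEN cy_rot]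
  hexagon_cy[OF cyc, THEN cy_rot, THEN cy_rot]

text \<open>All rotated triples and the negations of their reversals: with \<open>cy_irrefl\<close>,
  the simplifier can decide every \<open>cy\<close> statement about hexagon vertices that
  \<open>add_ear_insert\<close> raises.\<close>

lemmas hexagon_facts = cyc_facts cyc_facts[THEN cy_asym]

text \<open>Attach ears at \<open>u2\<close>, \<open>u4\<close>, \<open>u5\<close> to the triangle
  \<open>u1\<close>, \<open>u3\<close>, \<open>u6\<close>. The last ear rests on
  \<open>{u4, u6}\<close>, which the ear at \<open>u4\<close> creates. The next three constructions
  follow the same pattern.\<close>

lemma tri_zigzag1:
  "tri {u1, u2, u3, u4, u5, u6}
    (hexagon_sides u1 u2 u3 u4 u5 u6 \<union> {{u1, u3}, {u3, u6}, {u6, u4}})"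
proof -
  have d: "u1 \<noteq> u3" "u3 \<noteq> u6" "u6 \<noteq> u1"
    using hexagon_distinct[OF cyc] by auto
  have 1: "tri {u1, u3, u6} {{u1, u3}, {u3, u6}, {u6, u1}}" by (rule tri_triangle[OF d])
  note 2 = add_ear_insert[OF 1, of u1 u3 u2]
  note 3 = add_ear_insert[OF 2, of u3 u6 u4]
  note 4 = add_ear_insert[OF 3, of u4 u6 u5]
  have "tri (insert u5 (insert u4 (insert u2 {u1, u3, u6})))
    ({{u1, u3}, {u3, u6}, {u6, u1}} \<union> {{u1, u2}, {u2, u3}} \<union> {{u3, u4}, {u4, u6}} \<union>
      {{u4, u5}, {u5, u6}})"
    by (rule 4) (simp_all add: hexagon_facts)
  moreover have "insert u5 (insert u4 (insert u2 {u1, u3, u6})) = {u1, u2, u3, u4, u5, u6}"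
    by blast
  moreover have "{u4, u6} = {u6, u4}" by blast
  then have "{{u1, u3}, {u3, u6}, {u6, u1}} \<union> {{u1, u2}, {u2, u3}} \<union> {{u3, u4}, {u4, u6}} \<union>
      {{u4, u5}, {u5, u6}} = hexagon_sides u1 u2 u3 u4 u5 u6 \<union> {{u1, u3}, {u3, u6}, {u6, u4}}"
    unfolding hexagon_sides_def by (simp only:) (intro subset_antisym;
      simp only: insert_subset Un_subset_iff Un_iff insert_iff empty_subsetI simp_thms)
  ultimately show ?thesis by simp
qed

lemma tri_zigzag2:
  "tri {u1, u2, u3, u4, u5, u6}
    (hexagon_sides u1 u2 u3 u4 u5 u6 \<union> {{u1, u5}, {u5, u2}, {u2, u4}})"
proof -
  have d: "u4 \<noteq> u5" "u5 \<noteq> u2" "u2 \<noteq> u4"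
    using hexagon_distinct[OF cyc] by auto
  have 1: "tri {u4, u5, u2} {{u4, u5}, {u5, u2}, {u2, u4}}" by (rule tri_triangle[OF d])
  note 2 = add_ear_insert[OF 1, of u2 u4 u3]
  note 3 = add_ear_insert[OF 2, of u5 u2 u1]
  note 4 = add_ear_insert[OF 3, of u5 u1 u6]
  have "tri (insert u6 (insert u1 (insert u3 {u4, u5, u2})))
    ({{u4, u5}, {u5, u2}, {u2, u4}} \<union> {{u2, u3}, {u3, u4}} \<union> {{u5, u1}, {u1, u2}} \<union>
      {{u5, u6}, {u6, u1}})"
    by (rule 4) (simp_all add: hexagon_facts)
  moreover have "insert u6 (insert u1 (insert u3 {u4, u5, u2})) = {u1, u2, u3, u4, u5, u6}"
    by blast
  moreover have "{u5, u1} = {u1, u5}" by blast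
  then have "{{u4, u5}, {u5, u2}, {u2, u4}} \<union> {{u2, u3}, {u3, u4}} \<union> {{u5, u1}, {u1, u2}} \<union>
      {{u5, u6}, {u6, u1}} = hexagon_sides u1 u2 u3 u4 u5 u6 \<union> {{u1, u5}, {u5, u2}, {u2, u4}}"
    unfolding hexagon_sides_def by (simp only:) (intro subset_antisym;
      simp only: insert_subset Un_subset_iff Un_iff insert_iff empty_subsetI simp_thms)
  ultimately show ?thesis by simp
qed

lemma tri_inscribed1:
  "tri {u1, u2, u3, u4, u5, u6}
    (hexagon_sides u1 u2 u3 u4 u5 u6 \<union> {{u1, u3}, {u3, u5}, {u5, u1}})"
proof -
  have d: "u1 \<noteq> u3" "u3 \<noteq> u5" "u5 \<noteq> u1"
    using hexagon_distinct[OF cyc] by auto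
  have 1: "tri {u1, u3, u5} {{u1, u3}, {u3, u5}, {u5, u1}}" by (rule tri_triangle[OF d])
  note 2 = add_ear_insert[OF 1, of u1 u3 u2]
  note 3 = add_ear_insert[OF 2, of u3 u5 u4]
  note 4 = add_ear_insert[OF 3, of u5 u1 u6]
  have "tri (insert u6 (insert u4 (insert u2 {u1, u3, u5})))
    ({{u1, u3}, {u3, u5}, {u5, u1}} \<union> {{u1, u2}, {u2, u3}} \<union> {{u3, u4}, {u4, u5}} \<union>
      {{u5, u6}, {u6, u1}})"
    by (rule 4) (simp_all add: hexagon_facts)
  moreover have "insert u6 (insert u4 (insert u2 {u1, u3, u5})) = {u1, u2, u3, u4, u5, u6}"
    by blast
  moreover have "{{u1, u3}, {u3, u5}, {u5, u1}} \<union> {{u1, u2}, {u2, u3}} \<union> {{u3, u4}, {u4, u5}} \<union>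
      {{u5, u6}, {u6, u1}} = hexagon_sides u1 u2 u3 u4 u5 u6 \<union> {{u1, u3}, {u3, u5}, {u5, u1}}"
    unfolding hexagon_sides_def by (intro subset_antisym;
      simp only: insert_subset Un_subset_iff Un_iff insert_iff empty_subsetI simp_thms)
  ultimately show ?thesis by simp
qed

lemma tri_inscribed2:
  "tri {u1, u2, u3, u4, u5, u6}
    (hexagon_sides u1 u2 u3 u4 u5 u6 \<union> {{u2, u4}, {u4, u6}, {u6, u2}})"
proof -
  have d: "u2 \<noteq> u4" "u4 \<noteq> u6" "u6 \<noteq> u2"
    using hexagon_distinct[OF cyc] by auto
  have 1: "tri {u2, u4, u6} {{u2, u4}, {u4, u6}, {u6, u2}}" by (rule tri_triangle[OF d])
  note 2 = add_ear_insert[OF 1, of u2 u4 u3]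
  note 3 = add_ear_insert[OF 2, of u4 u6 u5]
  note 4 = add_ear_insert[OF 3, of u6 u2 u1]
  have "tri (insert u1 (insert u5 (insert u3 {u2, u4, u6})))
    ({{u2, u4}, {u4, u6}, {u6, u2}} \<union> {{u2, u3}, {u3, u4}} \<union> {{u4, u5}, {u5, u6}} \<union>
      {{u6, u1}, {u1, u2}})"
    by (rule 4) (simp_all add: hexagon_facts)
  moreover have "insert u1 (insert u5 (insert u3 {u2, u4, u6})) = {u1, u2, u3, u4, u5, u6}"
    by blast
  moreover have "{{u2, u4}, {u4, u6}, {u6, u2}} \<union> {{u2, u3}, {u3, u4}} \<union> {{u4, u5}, {u5, u6}} \<union>
      {{u6, u1}, {u1, u2}} = hexagon_sides u1 u2 u3 u4 u5 u6 \<union> {{u2, u4}, {u4, u6}, {u6, u2}}"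
    unfolding hexagon_sides_def by (intro subset_antisym;
      simp only: insert_subset Un_subset_iff Un_iff insert_iff empty_subsetI simp_thms)
  ultimately show ?thesis by simp
qed

lemma hexagon_swap_tri:
  assumes "hexagon_swap u1 u2 u3 u4 u5 u6 A B"
  shows "tri {u1, u2, u3, u4, u5, u6} (hexagon_sides u1 u2 u3 u4 u5 u6 \<union> A)"
    and "tri {u1, u2, u3, u4, u5, u6} (hexagon_sides u1 u2 u3 u4 u5 u6 \<union> B)"
  using assms tri_zigzag1 tri_zigzag2 tri_inscribed1 tri_inscribed2
  unfolding hexagon_swap_def by metis+

end

lemma hexagon_swap_diagonals:
  assumes "hexagon_swap u1 u2 u3 u4 u5 u6 A B"
  shows "A \<subseteq> hexagon_diagonals u1 u2 u3 u4 u5 u6" "B \<subseteq> hexagon_diagonals u1 u2 u3 u4 u5 u6"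
proof -
  have "{u6, u4} = {u4, u6}" "{u5, u2} = {u2, u5}" "{u5, u1} = {u1, u5}" "{u6, u2} = {u2, u6}"
    by blast+
  then show "A \<subseteq> hexagon_diagonals u1 u2 u3 u4 u5 u6" "B \<subseteq> hexagon_diagonals u1 u2 u3 u4 u5 u6"
    using assms unfolding hexagon_swap_def hexagon_diagonals_def
    by (elim disjE conjE; simp only: insert_subset insert_iff empty_subsetI; simp)+
qed

text \<open>Both triangulations of a pair force the same coincidences of colours: \<open>u1\<close>
  with \<open>u4\<close>, \<open>u2\<close> with \<open>u6\<close>, \<open>u3\<close> with
  \<open>u5\<close> for the zig-zags, and opposite vertices for the inscribed triangles. Read
  through these, the old inequalities become the new ones.\<close>

lemma hexagon_swap_proper:
  assumes "hexagon_swap u1 u2 u3 u4 u5 u6 A B" "proper y (hexagon_sides u1 u2 u3 u4 u5 u6 \<union> A)"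
  shows "proper y B"
proof -
  have e: "proper y {}" unfolding proper_def by simp
  have s: "y u1 \<noteq> y u2" "y u2 \<noteq> y u3" "y u3 \<noteq> y u4" "y u4 \<noteq> y u5" "y u5 \<noteq> y u6" "y u6 \<noteq> y u1"
    and A: "proper y A"
    using assms(2) unfolding hexagon_sides_def proper_def by blast+
  from assms(1)[unfolded hexagon_swap_def] show ?thesis
  proof (elim disjE conjE)
    assume AB: "A = {{u1, u3}, {u3, u6}, {u6, u4}}" "B = {{u1, u5}, {u5, u2}, {u2, u4}}"
    have a: "y u1 \<noteq> y u3" "y u3 \<noteq> y u6" "y u6 \<noteq> y u4" using A unfolding AB by (simp_all add: proper_insert)
    have "y u2 = y u6" using third_colour(2)[of "y u1" "y u3"] s a by metis
    moreover have "y u1 = y u4" using third_colour(2)[of "y u3" "y u6"] s a by metis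
    moreover have "y u5 = y u3" using third_colour(2)[of "y u6" "y u4"] s a by metis
    ultimately show ?thesis using s a unfolding AB by (simp add: proper_insert e)
  next
    assume AB: "A = {{u1, u5}, {u5, u2}, {u2, u4}}" "B = {{u1, u3}, {u3, u6}, {u6, u4}}"
    have a: "y u1 \<noteq> y u5" "y u5 \<noteq> y u2" "y u2 \<noteq> y u4" using A unfolding AB by (simp_all add: proper_insert)
    have "y u6 = y u2" using third_colour(2)[of "y u1" "y u5"] s a by metis
    moreover have "y u4 = y u1" using third_colour(2)[of "y u2" "y u5"] s a by metis
    moreover have "y u3 = y u5" using third_colour(2)[of "y u2" "y u4"] s a by metis
    ultimately show ?thesis using s a unfolding AB by (simp add: proper_insert e)
  next
    assume AB: "A = {{u1, u3}, {u3, u5}, {u5, u1}}" "B = {{u2, u4}, {u4, u6}, {u6, u2}}"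
    have a: "y u1 \<noteq> y u3" "y u3 \<noteq> y u5" "y u5 \<noteq> y u1" using A unfolding AB by (simp_all add: proper_insert)
    have "y u2 = y u5" using third_colour(2)[of "y u1" "y u3"] s a by metis
    moreover have "y u4 = y u1" using third_colour(2)[of "y u3" "y u5"] s a by metis
    moreover have "y u6 = y u3" using third_colour(2)[of "y u5" "y u1"] s a by metis
    ultimately show ?thesis using s a unfolding AB by (simp add: proper_insert e)
  next
    assume AB: "A = {{u2, u4}, {u4, u6}, {u6, u2}}" "B = {{u1, u3}, {u3, u5}, {u5, u1}}"
    have a: "y u2 \<noteq> y u4" "y u4 \<noteq> y u6" "y u6 \<noteq> y u2" using A unfolding AB by (simp_all add: proper_insert)
    have "y u3 = y u6" using third_colour(2)[of "y u2" "y u4"] s a by metis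
    moreover have "y u5 = y u2" using third_colour(2)[of "y u4" "y u6"] s a by metis
    moreover have "y u1 = y u4" using third_colour(2)[of "y u6" "y u2"] s a by metis
    ultimately show ?thesis using s a unfolding AB by (simp add: proper_insert e)
  qed
qed

text \<open>The move on edge sets that include the sides, without reference to \<open>m\<close>: the
  induction deletes vertices, after which the vertex set is no longer an interval
  \<open>{0..m}\<close>.\<close>

definition hmove :: "nat set set \<Rightarrow> nat set set \<Rightarrow> bool" where
  "hmove E E' \<longleftrightarrow> (\<exists>u1 u2 u3 u4 u5 u6 A B. cyclic_order [u1, u2, u3, u4, u5, u6] \<and>
     hexagon_sides u1 u2 u3 u4 u5 u6 \<subseteq> E \<and> hexagon_swap u1 u2 u3 u4 u5 u6 A B \<and>
     E \<inter> hexagon_diagonals u1 u2 u3 u4 u5 u6 = A \<and> E' = (E - A) \<union> B)"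

lemma hmove_tri_proper:
  assumes "hmove E E'" "tri V E" "finite V"
  shows "tri V E'" "proper y E \<Longrightarrow> proper y E'"
proof -
  obtain u1 u2 u3 u4 u5 u6 A B where cyc: "cyclic_order [u1, u2, u3, u4, u5, u6]"
    and sides: "hexagon_sides u1 u2 u3 u4 u5 u6 \<subseteq> E" and sw: "hexagon_swap u1 u2 u3 u4 u5 u6 A B"
    and A: "E \<inter> hexagon_diagonals u1 u2 u3 u4 u5 u6 = A" and E': "E' = (E - A) \<union> B"
    using assms(1) unfolding hmove_def by blast
  let ?H = "{u1, u2, u3, u4, u5, u6}" and ?S = "hexagon_sides u1 u2 u3 u4 u5 u6"
  have "{u1, u2} \<in> E" "{u3, u4} \<in> E" "{u5, u6} \<in> E"
    using sides unfolding hexagon_sides_def by blast+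
  then have "?H \<subseteq> V" using triD(1,2)[OF assms(2)] by blast
  then have "tri V ((E - edges ?H) \<union> (?S \<union> B))"
    using retriangulate[OF assms(2,3) _ _ hexagon_swap_tri(2)[OF cyc sw]]
      side_hexagon[OF cyc] sides by blast
  moreover have "(E - edges ?H) \<union> (?S \<union> B) = (E - A) \<union> B"
    using edges_hexagon[OF cyc] sides A by blast
  ultimately show "tri V E'" using E' by simp
  show "proper y E'" if "proper y E"
  proof -
    have "proper y (?S \<union> A)" by (rule proper_mono[OF that]) (use sides A in blast)
    then have "proper y B" by (rule hexagon_swap_proper[OF sw])
    then show ?thesis using that unfolding E' proper_def by blast
  qed
qed

text \<open>The sides and \<open>A\<close> form a maximal noncrossing set in the hexagon, so any
  further hexagon diagonal in \<open>E\<close> would cross one of them. It is therefore enough to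
  know that \<open>A\<close> is present.\<close>

lemma hmoveI:
  assumes "tri V E" "cyclic_order [u1, u2, u3, u4, u5, u6]" "hexagon_swap u1 u2 u3 u4 u5 u6 A B"
    and "hexagon_sides u1 u2 u3 u4 u5 u6 \<subseteq> E" "A \<subseteq> E"
  shows "hmove E ((E - A) \<union> B)"
proof -
  let ?H = "{u1, u2, u3, u4, u5, u6}" and ?S = "hexagon_sides u1 u2 u3 u4 u5 u6"
  have "d \<in> A" if d: "d \<in> E" "d \<in> hexagon_diagonals u1 u2 u3 u4 u5 u6" for d
  proof -
    have "d \<in> edges ?H" using edges_hexagon[OF assms(2)] d by blast
    moreover have "\<forall>e\<in>?S \<union> A. \<not> crossing d e"
      using assms(1,4,5) d(1) unfolding tri_def by blast
    ultimately have "d \<in> ?S \<union> A"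
      using hexagon_swap_tri(1)[OF assms(2,3)] unfolding tri_def by blast
    then show ?thesis using edges_hexagon(2)[OF assms(2)] d(2) by blast
  qed
  then have "E \<inter> hexagon_diagonals u1 u2 u3 u4 u5 u6 = A"
    using hexagon_swap_diagonals(1)[OF assms(3)] assms(5) by blast
  then show ?thesis using assms unfolding hmove_def by blast
qed

text \<open>The sides of the hexagon of a move are present, while no edge at \<open>u\<close> is, so
  \<open>u\<close> is never one of its vertices. Hence moves of the polygon without the ear remain
  moves after the ear is glued on.\<close>

lemma hmove_add_ear:
  assumes "hmove\<^sup>*\<^sup>* E F" "\<And>e. e \<in> E \<Longrightarrow> u \<notin> e" "\<And>d. d \<in> D \<Longrightarrow> u \<in> d"
  shows "hmove\<^sup>*\<^sup>* (E \<union> D) (F \<union> D)"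
proof -
  have "hmove\<^sup>*\<^sup>* (E \<union> D) (F \<union> D) \<and> (\<forall>e\<in>F. u \<notin> e)"
    using assms(1)
  proof induction
    case base
    show ?case using assms(2) by blast
  next
    case (step F G)
    obtain u1 u2 u3 u4 u5 u6 A B where cyc: "cyclic_order [u1, u2, u3, u4, u5, u6]"
      and sides: "hexagon_sides u1 u2 u3 u4 u5 u6 \<subseteq> F" and sw: "hexagon_swap u1 u2 u3 u4 u5 u6 A B"
      and A: "F \<inter> hexagon_diagonals u1 u2 u3 u4 u5 u6 = A" and G: "G = (F - A) \<union> B"
      using step.hyps(2) unfolding hmove_def by blast
    have "{u1, u2} \<in> F" "{u3, u4} \<in> F" "{u5, u6} \<in> F"
      using sides unfolding hexagon_sides_def by blast+
    then have u: "u \<notin> {u1, u2, u3, u4, u5, u6}" using step.IH by blast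
    have HD: "u \<notin> e" if "e \<in> hexagon_diagonals u1 u2 u3 u4 u5 u6" for e
      using edges_hexagon(1)[OF cyc] that u unfolding edges_def by blast
    then have "D \<inter> hexagon_diagonals u1 u2 u3 u4 u5 u6 = {}" using assms(3) by blast
    then have "(F \<union> D) \<inter> hexagon_diagonals u1 u2 u3 u4 u5 u6 = A" "G \<union> D = ((F \<union> D) - A) \<union> B"
      using A G by blast+
    then have "hmove (F \<union> D) (G \<union> D)"
      unfolding hmove_def using cyc sides sw by blast
    moreover have "\<forall>e\<in>G. u \<notin> e"
      using G HD hexagon_swap_diagonals(2)[OF sw] step.IH by blast
    ultimately show ?case using step.IH by (meson rtranclp.rtrancl_into_rtrancl)
  qed
  then show ?thesis by blast
qed

section \<open>Connectivity under hexagonal moves\<close>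

lemma side_unique:
  "side V a b \<Longrightarrow> side V a c \<Longrightarrow> b = c"
  "side V b a \<Longrightarrow> side V c a \<Longrightarrow> b = c"
  unfolding side_def by (metis cy_total cy_rot)+

lemma side_cy:
  assumes "side V a b" "x \<in> V" "x \<noteq> a" "x \<noteq> b"
  shows "cy x a b"
proof -
  have "\<not> cy a x b" "a \<noteq> b" using assms unfolding side_def by auto
  then show ?thesis using cy_total[of a x b] assms(3,4) cy_rot by blast
qed

lemma consecutive_Diff: "consecutive V p u s \<Longrightarrow> v \<notin> {p, u, s} \<Longrightarrow> consecutive (V - {v}) p u s"
  unfolding consecutive_def by blast

text \<open>Take two nonadjacent ears in each triangulation. If every ear of \<open>E\<close> were
  adjacent to every ear of \<open>E'\<close>, then \<open>E\<close> would contain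
  \<open>{v, v'}\<close>, forcing equal colours at \<open>u\<close> and \<open>u'\<close>, while
  \<open>E'\<close> would contain \<open>{u, u'}\<close>, forcing different ones. The case
  \<open>u = v\<close> is still allowed in the conclusion.\<close>

lemma nonadjacent_ears:
  assumes "tri V E" "tri V E'" "finite V" "card V \<ge> 4" "proper y E" "proper y E'"
  obtains p u s q v t where "consecutive V p u s" "{p, s} \<in> E" "consecutive V q v t" "{q, t} \<in> E'" "v \<notin> {p, s}"
proof -
  obtain p u s p' u' s' where u: "consecutive V p u s" "{p, s} \<in> E" and u': "consecutive V p' u' s'" "{p', s'} \<in> E"
    and uu': "u' \<notin> {p, u, s}"
    using two_ears[OF assms(1,3,4)] by metis
  obtain q v t q' v' t' where v: "consecutive V q v t" "{q, t} \<in> E'" and v': "consecutive V q' v' t'" "{q', t'} \<in> E'"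
    and vv': "v' \<notin> {q, v, t}"
    using two_ears[OF assms(2,3,4)] by metis
  show thesis
  proof (cases "v \<notin> {p, s} \<or> v' \<notin> {p, s} \<or> v \<notin> {p', s'} \<or> v' \<notin> {p', s'}")
    case True
    then show ?thesis using that u u' v v' by metis
  next
    case False
    have sides: "side V p u" "side V u s" "side V p' u'" "side V u' s'" "side V q v" "side V v t"
      using consecutiveD(9,10)[OF u(1)] consecutiveD(9,10)[OF u'(1)] consecutiveD(9,10)[OF v(1)] by auto
    have "v \<noteq> v'" using vv' by auto
    then have ps: "{v, v'} = {p, s}" "{v, v'} = {p', s'}" using False by auto
    have "u \<in> {q, t}" "u' \<in> {q, t}"
      using False sides side_unique by blast+
    moreover have "u \<noteq> u'" using uu' by auto
    ultimately have "{u, u'} = {q, t}" by auto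
    then have "y u \<noteq> y u'" using v(2) properD[OF assms(6)] by metis
    have E: "y p \<noteq> y u" "y u \<noteq> y s" "y p' \<noteq> y u'" "y u' \<noteq> y s'" "y p \<noteq> y s"
      using sides(1-4) side_in_tri[OF assms(1)] properD[OF assms(5)] u(2) by blast+
    have "y u' \<noteq> y p" "y u' \<noteq> y s"
      using ps E(3,4) unfolding doubleton_eq_iff by metis+
    then have "y u = y u'" using third_colour(2)[of "y p" "y s"] E by metis
    then show ?thesis using \<open>y u \<noteq> y u'\<close> by blast
  qed
qed

text \<open>Without \<open>u\<close> at least three vertices remain, so all colours still occur and
  \<open>c\<close> can only sit at \<open>v\<close>. Then \<open>fan_at_unique_colour\<close>
  applies to the smaller triangulation.\<close>

lemma ear_fan:
  assumes "tri V E" "finite V" "card V \<ge> 4" "proper y E" "consecutive V p u s" "{p, s} \<in> E" "v \<in> V" "v \<noteq> u"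
    and "\<And>x. x \<in> V - {u} - {v} \<Longrightarrow> y x \<noteq> c"
  shows "y v = c" "\<And>w. w \<in> V \<Longrightarrow> w \<noteq> u \<Longrightarrow> w \<noteq> v \<Longrightarrow> {v, w} \<in> E"
proof -
  have tri: "tri (V - {u}) {e \<in> E. u \<notin> e}" by (rule remove_ear(1)[OF assms(1,5,6)])
  have pr: "proper y {e \<in> E. u \<notin> e}" by (rule proper_mono[OF assms(4)]) blast
  have "card (V - {u}) \<ge> 3" using assms(2,3) consecutiveD(3)[OF assms(5)] by simp
  then show v: "y v = c"
    using tri_all_colours[OF tri _ _ pr, of c] assms(2,9) by blast
  show "{v, w} \<in> E" if "w \<in> V" "w \<noteq> u" "w \<noteq> v" for w
  proof -
    have "{v, w} \<in> {e \<in> E. u \<notin> e}"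
    proof (rule fan_at_unique_colour[OF tri _ pr])
      show "y x \<noteq> y v" if "x \<in> V - {u}" "x \<noteq> v" for x using assms(9) v that by blast
    qed (use assms that in auto)
    then show ?thesis by blast
  qed
qed

text \<open>Removing both vertices creates only the sides \<open>ps\<close> and \<open>qt\<close>,
  whose ends differ in colour because they are edges of \<open>E\<close> and of \<open>E'\<close>.
  So the rest has a compatible triangulation, to which \<open>v\<close> and then \<open>u\<close>
  are glued as ears.\<close>

lemma common_ears:
  assumes "tri V E" "tri V E'" "finite V" "proper y E" "proper y E'"
    and "consecutive V p u s" "{p, s} \<in> E" "consecutive V q v t" "{q, t} \<in> E'" "v \<notin> {p, u, s}" "u \<notin> {q, v, t}"
    and "\<And>c. \<exists>x\<in>V - {u} - {v}. y x = c"
  obtains F where "tri V F" "proper y F" "{p, s} \<in> F" "{q, t} \<in> F"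
proof -
  have nbv: "consecutive (V - {u}) q v t" by (rule consecutive_Diff[OF assms(8,11)])
  have ps: "y p \<noteq> y s" and qt: "y q \<noteq> y t"
    using properD assms(4,5,7,9) by blast+
  have V: "y a \<noteq> y b" if "side V a b" for a b
    using side_in_tri[OF assms(1) that] properD[OF assms(4)] by blast
  have "y a \<noteq> y b" if "side (V - {u} - {v}) a b" for a b
    using side_Diff_cases[OF nbv that] side_Diff_cases[OF assms(6)] ps qt V by blast
  then obtain F where F: "tri (V - {u} - {v}) F" "proper y F"
    using rainbow_tri_exists[of "V - {u} - {v}" y] assms(3,12) by blast
  let ?F1 = "F \<union> {{q, v}, {v, t}}"
  let ?F = "?F1 \<union> {{p, u}, {u, s}}"
  have F1: "tri (V - {u}) ?F1" by (rule add_ear[OF nbv F(1)])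
  show thesis
  proof
    show "tri V ?F" by (rule add_ear[OF assms(6) F1])
    show "proper y ?F"
      using F(2) V consecutiveD(9,10)[OF assms(6)] consecutiveD(9,10)[OF assms(8)] by (simp add: proper_insert)
    show "{p, s} \<in> ?F" using side_in_tri[OF F1 side_Diff[OF assms(6)]] by blast
    show "{q, t} \<in> ?F" using side_in_tri[OF F(1) side_Diff[OF nbv]] by blast
  qed
qed

lemma tri_small_unique:
  assumes "tri V E" "tri V E'" "finite V" "card V \<le> 3"
  shows "E = E'"
  using tri_small[OF assms(1,3,4)] tri_small[OF assms(2,3,4)] tri_edge[OF assms(1)] tri_edge[OF assms(2)]
  by (metis subsetI subset_antisym)

text \<open>The fan at \<open>v\<close> supplies the hexagon in \<open>E\<close>. Since
  \<open>E'\<close> contains the fan at \<open>u\<close>, it suffices to create an edge from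
  \<open>u\<close> that cuts off a neighbour of \<open>u\<close>. Which move does so depends on the
  neighbours that \<open>u\<close> and \<open>v\<close> share.\<close>

lemma two_fans_move:
  assumes "tri V E" "tri V E'" "finite V" "proper y E" "proper y E'"
    and "consecutive V p u s" "{p, s} \<in> E" "consecutive V q v t" "{q, t} \<in> E'" "v \<notin> {p, u, s}" "u \<notin> {q, v, t}"
    and c: "\<And>x. x \<in> V \<Longrightarrow> x \<noteq> u \<Longrightarrow> x \<noteq> v \<Longrightarrow> y x \<noteq> c"
    and fan: "\<And>w. w \<in> V \<Longrightarrow> w \<noteq> u \<Longrightarrow> w \<noteq> v \<Longrightarrow> {v, w} \<in> E"
    and fan': "\<And>w. w \<in> V \<Longrightarrow> w \<noteq> u \<Longrightarrow> w \<noteq> v \<Longrightarrow> {u, w} \<in> E'"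
  shows "\<exists>F a x b. hmove\<^sup>*\<^sup>* E F \<and> tri V F \<and> proper y F \<and> consecutive V a x b \<and> {a, b} \<in> F \<and> {a, b} \<in> E'"
    (is ?thesis)
proof -
  note u = consecutiveD(1-4)[OF assms(6)] and v = consecutiveD(1-4)[OF assms(8)]
  have pu: "side V p u" and us: "side V u s" and qv: "side V q v" and vt: "side V v t"
    using consecutiveD(9,10)[OF assms(6)] consecutiveD(9,10)[OF assms(8)] by auto
  have ne: "p \<noteq> u" "u \<noteq> s" "q \<noteq> v" "v \<noteq> t" "v \<noteq> p" "v \<noteq> u" "v \<noteq> s" "u \<noteq> q" "u \<noteq> t"
    using consecutiveD(7,8)[OF assms(6)] consecutiveD(7,8)[OF assms(8)] assms(10,11) by auto
  note E = side_in_tri[OF assms(1)]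
  have SV: "a \<in> V" "b \<in> V" "a \<noteq> b" if "side V a b" for a b using that unfolding side_def by auto
  have col: "y a \<noteq> y b" if "side V a b" for a b using properD[OF assms(4) E[OF that]] .
  have step: ?thesis
    if "cyclic_order [u1, u2, u3, u4, u5, u6]" "hexagon_swap u1 u2 u3 u4 u5 u6 A B"
      "hexagon_sides u1 u2 u3 u4 u5 u6 \<subseteq> E" "A \<subseteq> E" "{a, b} \<in> B" "consecutive V a x b" "{a, b} \<in> E'"
    for u1 u2 u3 u4 u5 u6 A B a x b
  proof -
    have m: "hmove E ((E - A) \<union> B)" using hmoveI[OF assms(1)] that(1-4) by blast
    show ?thesis
      using hmove_tri_proper[OF m assms(1,3)] assms(4) that(5-7) m by blast
  qed
  obtain a2 where a2: "side V s a2" using side_succ[OF assms(3) u(2,1)] u(4) by metis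
  obtain b2 where b2: "side V b2 p" using side_pred[OF assms(3) u(2,1)] u(4) by metis
  have a2u: "a2 \<noteq> u" using a2 pu u(4) side_unique(2) by blast
  have b2u: "b2 \<noteq> u" using b2 us u(4) side_unique(1) by blast
  consider "s \<noteq> q" "p \<noteq> t" | "s = q" "p = t" | "s = q" "p \<noteq> t" | "s \<noteq> q" "p = t" by blast
  then show ?thesis
  proof cases
    case 1
    \<comment> \<open>No shared neighbour: the inscribed triangle \<open>v\<close>,
      \<open>p\<close>, \<open>s\<close> is replaced by \<open>b2\<close>, \<open>u\<close>,
      \<open>a2\<close>, and \<open>s\<close> becomes an ear.\<close>
    have a2v: "a2 \<noteq> v" using a2 qv 1(1) side_unique(2) by blast
    have b2v: "b2 \<noteq> v" using b2 vt 1(2) side_unique(1) by blast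
    show ?thesis
    proof (rule step)
      show "cyclic_order [v, b2, p, u, s, a2]"
        using side_cy[OF b2] side_cy[OF pu] side_cy[OF us] side_cy[OF a2] v(3) ne a2v b2v
        by (intro cyclic_order_hexagonI) auto
      show "hexagon_swap v b2 p u s a2 {{v, p}, {p, s}, {s, v}} {{b2, u}, {u, a2}, {a2, b2}}"
        unfolding hexagon_swap_def by simp
      show "hexagon_sides v b2 p u s a2 \<subseteq> E"
        unfolding hexagon_sides_def
        using fan[OF SV(1)[OF b2] b2u b2v] E[OF b2] E[OF pu] E[OF us] E[OF a2]
          fan[OF SV(2)[OF a2] a2u a2v] by (simp add: insert_commute)
      show "{{v, p}, {p, s}, {s, v}} \<subseteq> E"
        using fan[OF u(1)] fan[OF u(2)] ne assms(7) by (simp add: insert_commute)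
      show "{u, a2} \<in> {{b2, u}, {u, a2}, {a2, b2}}" by simp
      show "consecutive V u s a2" using consecutiveI[OF us a2] a2u by blast
      show "{u, a2} \<in> E'" using fan' SV(2)[OF a2] a2u a2v by blast
    qed
  next
    case 2
    \<comment> \<open>Both neighbours are shared: the polygon is a quadrilateral and
      \<open>E\<close> already has the ear at \<open>v\<close>.\<close>
    then have "{q, t} \<in> E" using assms(7) by (simp add: insert_commute)
    then show ?thesis using assms(1,4,8,9) by blast
  next
    case 3
    \<comment> \<open>Only \<open>s\<close> is shared: a zig-zag move turns \<open>p\<close> into an
      ear.\<close>
    have sv: "side V s v" using qv 3(1) by simp
    have b2v: "b2 \<noteq> v" using b2 vt 3(2) side_unique(1) by blast
    have sb2: "s \<noteq> b2" using b2 sv ne(5) side_unique(1) by blast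
    \<comment> \<open>Away from \<open>u\<close> and \<open>v\<close> only two colours occur, so
      \<open>s\<close> and \<open>b2\<close>, both adjacent to \<open>p\<close> in \<open>E\<close>,
      agree. As \<open>s = q\<close> and \<open>t\<close> differ in colour, \<open>b2\<close> is not
      \<open>t\<close>, which leaves room for a further vertex \<open>b3\<close> other than
      \<open>v\<close>.\<close>
    have "y s = y b2"
      using third_colour(2)[of c "y p"] c[OF u(2)] c[OF u(1)] c[OF SV(1)[OF b2] b2u b2v] ne
        col[OF b2] properD[OF assms(4,7)] by metis
    then have b2t: "b2 \<noteq> t" using properD[OF assms(5,9)] 3(1) by auto
    obtain b3 where b3: "side V b3 b2"
      using side_pred[OF assms(3) u(2) SV(1)[OF b2] sb2] by metis
    have b3v: "b3 \<noteq> v" using b3 vt b2t side_unique(1) by blast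
    have b3u: "b3 \<noteq> u" using b3 us sb2 side_unique(1) by blast
    have sb3: "s \<noteq> b3" using b3 sv b2v side_unique(1) by blast
    show ?thesis
    proof (rule step)
      show "cyclic_order [s, v, b3, b2, p, u]"
        using side_cy[OF sv SV(1)[OF b3]] side_cy[OF b3 u(2)] side_cy[OF b2 u(2)] side_cy[OF pu u(2)]
          sb2 sb3 u(4) ne b3v
        by (intro cyclic_order_hexagonI) (auto intro: cy_rot)
      show "hexagon_swap s v b3 b2 p u {{s, p}, {p, v}, {v, b2}} {{s, b3}, {b3, u}, {u, b2}}"
        unfolding hexagon_swap_def by simp
      show "hexagon_sides s v b3 b2 p u \<subseteq> E"
        unfolding hexagon_sides_def
        using fan[OF SV(1)[OF b3] b3u b3v] E[OF b3] E[OF b2] E[OF pu] E[OF us] E[OF sv] by simp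
      show "{{s, p}, {p, v}, {v, b2}} \<subseteq> E"
        using fan[OF u(1)] fan[OF SV(1)[OF b2] b2u b2v] ne assms(7) by (simp add: insert_commute)
      show "{b2, u} \<in> {{s, b3}, {b3, u}, {u, b2}}" by (simp add: insert_commute)
      show "consecutive V b2 p u" using consecutiveI[OF b2 pu] b2u by blast
      show "{b2, u} \<in> E'" using fan'[OF SV(1)[OF b2] b2u b2v] by (simp add: insert_commute)
    qed
  next
    case 4
    \<comment> \<open>Mirror image of the previous case: successors replace predecessors, and
      \<open>s\<close> becomes the ear.\<close>
    have vp: "side V v p" using vt 4(2) by simp
    have a2v: "a2 \<noteq> v" using a2 qv 4(1) side_unique(2) by blast
    have pa2: "p \<noteq> a2" using a2 vp ne(7) side_unique(2) by blast
    have "y p = y a2"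
      using third_colour(2)[of c "y s"] c[OF u(2)] c[OF u(1)] c[OF SV(2)[OF a2] a2u a2v] ne
        col[OF a2] properD[OF assms(4,7)] by metis
    then have a2q: "a2 \<noteq> q" using properD[OF assms(5,9)] 4(2) by auto
    obtain a3 where a3: "side V a2 a3"
      using side_succ[OF assms(3) SV(2)[OF a2] u(1)] pa2 by metis
    have a3v: "a3 \<noteq> v" using a3 qv a2q side_unique(2) by blast
    have a3u: "a3 \<noteq> u" using a3 pu pa2 side_unique(2) by blast
    show ?thesis
    proof (rule step)
      show "cyclic_order [a2, a3, v, p, u, s]"
        using cy_rot[OF side_cy[OF a3 v(3)], THEN cy_rot] side_cy[OF a3 v(3)]
          side_cy[OF vp SV(2)[OF a2]] side_cy[OF pu SV(2)[OF a2]] side_cy[OF us SV(2)[OF a2]]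
          SV(3)[OF a2] pa2 a2u a2v a3v
        by (intro cyclic_order_hexagonI) (auto intro: cy_rot)
      show "hexagon_swap a2 a3 v p u s {{a2, v}, {v, s}, {s, p}} {{a2, u}, {u, a3}, {a3, p}}"
        unfolding hexagon_swap_def by simp
      show "hexagon_sides a2 a3 v p u s \<subseteq> E"
        unfolding hexagon_sides_def
        using fan[OF SV(2)[OF a3] a3u a3v] E[OF a3] E[OF a2] E[OF pu] E[OF us] E[OF vp]
        by (simp add: insert_commute)
      show "{{a2, v}, {v, s}, {s, p}} \<subseteq> E"
        using fan[OF u(2)] fan[OF SV(2)[OF a2] a2u a2v] ne assms(7) by (simp add: insert_commute)
      show "{u, a2} \<in> {{a2, u}, {u, a3}, {a3, p}}" by (simp add: insert_commute)
      show "consecutive V u s a2" using consecutiveI[OF us a2] a2u by blast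
      show "{u, a2} \<in> E'" using fan'[OF SV(2)[OF a2] a2u a2v] .
    qed
  qed
qed

lemma hmove_connected:
  assumes "finite V" "tri V E" "tri V E'" "proper y E" "proper y E'"
  shows "hmove\<^sup>*\<^sup>* E E'"
  using assms
proof (induction "card V" arbitrary: V E E' rule: less_induct)
  case less
  \<comment> \<open>The induction hypothesis in usable form: triangulations with a common ear are
    connected, since the moves after cutting it off lift back by
    \<open>hmove_add_ear\<close>.\<close>
  have shared: "hmove\<^sup>*\<^sup>* F F'"
    if nb: "consecutive V p u s" and ps: "{p, s} \<in> F" "{p, s} \<in> F'" and F: "tri V F" "tri V F'"
      and pr: "proper y F" "proper y F'" for F F' p u s
  proof -
    have "hmove\<^sup>*\<^sup>* {e \<in> F. u \<notin> e} {e \<in> F'. u \<notin> e}"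
    proof (rule less.hyps)
      show "card (V - {u}) < card V" by (rule card_Diff1_less[OF less.prems(1) consecutiveD(3)[OF nb]])
      show "finite (V - {u})" using less.prems(1) by simp
      show "tri (V - {u}) {e \<in> F. u \<notin> e}" by (rule remove_ear(1)[OF F(1) nb ps(1)])
      show "tri (V - {u}) {e \<in> F'. u \<notin> e}" by (rule remove_ear(1)[OF F(2) nb ps(2)])
      show "proper y {e \<in> F. u \<notin> e}" by (rule proper_mono[OF pr(1)]) blast
      show "proper y {e \<in> F'. u \<notin> e}" by (rule proper_mono[OF pr(2)]) blast
    qed
    then have "hmove\<^sup>*\<^sup>* ({e \<in> F. u \<notin> e} \<union> {{p, u}, {u, s}}) ({e \<in> F'. u \<notin> e} \<union> {{p, u}, {u, s}})"
      by (rule hmove_add_ear) auto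
    then show ?thesis
      using remove_ear(2)[OF F(1) nb ps(1)] remove_ear(2)[OF F(2) nb ps(2)] by simp
  qed
  show ?case
  proof (cases "card V \<le> 3")
    case True
    then have "E = E'" using tri_small_unique less.prems(1-3) by blast
    then show ?thesis by simp
  next
    case False
    then have card: "card V \<ge> 4" by simp
    obtain p u s q v t where u: "consecutive V p u s" "{p, s} \<in> E" and v: "consecutive V q v t" "{q, t} \<in> E'"
      and ne: "v \<notin> {p, s}"
      using nonadjacent_ears[OF less.prems(2,3,1) card less.prems(4,5)] by metis
    note sides = consecutiveD(9,10)[OF u(1)] consecutiveD(9,10)[OF v(1)]
    show ?thesis
    proof (cases "u = v")
      case True
      then have "q = p" "t = s" using sides side_unique by blast+
      then show ?thesis using shared[OF u(1,2) _ less.prems(2-5)] v(2) by simp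
    next
      case False
      \<comment> \<open>If \<open>u\<close> preceded \<open>v\<close>, then \<open>v\<close> would
        be the successor \<open>s\<close> of \<open>u\<close>; likewise on the other side.\<close>
      have "u \<noteq> q" using sides(2,3) side_unique(1)[of V u s v] ne by blast
      moreover have "u \<noteq> t" using sides(1,4) side_unique(2)[of V p u v] ne by blast
      ultimately have vn: "v \<notin> {p, u, s}" and un: "u \<notin> {q, v, t}" using ne False by auto
      show ?thesis
      proof (cases "\<forall>c. \<exists>x\<in>V - {u} - {v}. y x = c")
        case True
        then obtain F where F: "tri V F" "proper y F" "{p, s} \<in> F" "{q, t} \<in> F"
          using common_ears[OF less.prems(2,3,1,4,5) u v vn un] by metis
        have "hmove\<^sup>*\<^sup>* E F" using shared[OF u F(3) less.prems(2) F(1) less.prems(4) F(2)] .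
        moreover have "hmove\<^sup>*\<^sup>* F E'"
          using shared[OF v(1) F(4) v(2) F(1) less.prems(3) F(2) less.prems(5)] .
        ultimately show ?thesis by simp
      next
        case False
        then obtain c where c: "\<And>x. x \<in> V \<Longrightarrow> x \<noteq> u \<Longrightarrow> x \<noteq> v \<Longrightarrow> y x \<noteq> c" by blast
        have fan: "{v, w} \<in> E" if "w \<in> V" "w \<noteq> u" "w \<noteq> v" for w
          using ear_fan(2)[OF less.prems(2,1) card less.prems(4) u consecutiveD(3)[OF v(1)] _ _ that, of c]
            c vn by blast
        have fan': "{u, w} \<in> E'" if "w \<in> V" "w \<noteq> u" "w \<noteq> v" for w
          using ear_fan(2)[OF less.prems(3,1) card less.prems(5) v consecutiveD(3)[OF u(1)] _ _ that(1,3,2), of c]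
            c un by blast
        obtain F a x b where F: "hmove\<^sup>*\<^sup>* E F" "tri V F" "proper y F" "consecutive V a x b" "{a, b} \<in> F"
            "{a, b} \<in> E'"
          using two_fans_move[OF less.prems(2,3,1,4,5) u v vn un c fan fan'] by blast
        have "hmove\<^sup>*\<^sup>* F E'" using shared[OF F(4,5,6,2) less.prems(3) F(3) less.prems(5)] .
        then show ?thesis using F(1) by simp
      qed
    qed
  qed
qed

section \<open>Triangulations of the labelled polygon\<close>

lemma sides_side:
  assumes "m \<ge> 1" "e \<in> sides m"
  obtains a b where "e = {a, b}" "side {0..m} a b"
proof -
  have "side {0..m} i (i + 1)" if "i < m" for i
    using that unfolding side_def cy_def by auto
  moreover have "side {0..m} m 0"
    using assms(1) unfolding side_def cy_def by auto
  ultimately show thesis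
    using assms(2) that unfolding sides_def by (auto simp: insert_commute)
qed

lemma edges_polygon: "m \<ge> 1 \<Longrightarrow> edges {0..m} = diagonals m \<union> sides m"
proof -
  assume m: "m \<ge> 1"
  have "sides m \<subseteq> edges {0..m}" using m unfolding sides_def by auto
  moreover have "edges {0..m} = {{i, j} | i j. i \<le> m \<and> j \<le> m \<and> i \<noteq> j}"
    unfolding edges_def by simp
  ultimately show ?thesis unfolding diagonals_def by blast
qed

lemma crossing_sym: "crossing d e \<longleftrightarrow> crossing e d"
  unfolding crossing_def by blast

lemma crossing_irrefl: "\<not> crossing d d"
  unfolding crossing_def by (auto simp: doubleton_eq_iff)

lemma sides_not_crossing:
  assumes "m \<ge> 1" "s \<in> sides m" "e \<in> edges {0..m}"
  shows "\<not> crossing s e"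
proof -
  obtain a b where "s = {a, b}" "side {0..m} a b" using sides_side[OF assms(1,2)] .
  moreover obtain c d where "e = {c, d}" "c \<in> {0..m}" "d \<in> {0..m}"
    using assms(3) unfolding edges_def by blast
  ultimately show ?thesis using side_not_cross(1) crossing_iff by metis
qed

text \<open>No side crosses any segment, so adding the sides keeps \<open>T\<close> noncrossing. A
  segment compatible with the result is a side, or a diagonal to which the maximality of
  \<open>T\<close> applies.\<close>

lemma triangulation_tri:
  assumes "m \<ge> 1" "triangulation m T"
  shows "tri {0..m} (T \<union> sides m)" "T \<inter> sides m = {}"
proof -
  have T: "T \<subseteq> diagonals m" "\<And>d e. d \<in> T \<Longrightarrow> e \<in> T \<Longrightarrow> \<not> crossing d e"
    and max: "\<And>S. noncrossing m S \<Longrightarrow> T \<subseteq> S \<Longrightarrow> S = T"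
    using assms(2) unfolding triangulation_def noncrossing_def by auto
  note V = edges_polygon[OF assms(1)]
  show "T \<inter> sides m = {}" using T(1) unfolding diagonals_def by blast
  have 1: "T \<union> sides m \<subseteq> edges {0..m}" using T(1) V by blast
  moreover have "\<not> crossing d e" if "d \<in> T \<union> sides m" "e \<in> T \<union> sides m" for d e
    using that T(2) sides_not_crossing[OF assms(1)] 1 crossing_sym by blast
  moreover have "d \<in> T \<union> sides m"
    if d: "d \<in> edges {0..m}" "\<forall>e\<in>T \<union> sides m. \<not> crossing d e" for d
  proof (cases "d \<in> sides m")
    case False
    then have "d \<in> diagonals m" using d(1) V by blast
    then have "noncrossing m (insert d T)"
      unfolding noncrossing_def using T d(2) crossing_sym crossing_irrefl by blast
    then have "insert d T = T" using max by blast
    then show ?thesis by blast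
  qed blast
  ultimately show "tri {0..m} (T \<union> sides m)" unfolding tri_def by blast
qed

text \<open>A polygon side joining two hexagon vertices is also a side of the hexagon. Consequently
  adding or deleting polygon sides does not disturb the exchange of \<open>A\<close> and
  \<open>B\<close>, and the two notions of move correspond.\<close>

lemma hexagon_diagonals_not_sides:
  assumes "m \<ge> 1" "cyclic_order [u1, u2, u3, u4, u5, u6]" "{u1, u2, u3, u4, u5, u6} \<subseteq> {0..m}"
  shows "hexagon_diagonals u1 u2 u3 u4 u5 u6 \<inter> sides m = {}"
proof -
  let ?H = "{u1, u2, u3, u4, u5, u6}"
  have False if e: "e \<in> hexagon_diagonals u1 u2 u3 u4 u5 u6" "e \<in> sides m" for e
  proof -
    obtain a b where ab: "e = {a, b}" "side {0..m} a b" using sides_side[OF assms(1) e(2)] .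
    have "{a, b} \<in> edges ?H" using e(1) ab(1) edges_hexagon(1)[OF assms(2)] by blast
    then have "a \<in> ?H" "b \<in> ?H" unfolding edges_iff by blast+
    then have "side ?H a b" using ab(2) assms(3) unfolding side_def by blast
    then have "e \<in> hexagon_sides u1 u2 u3 u4 u5 u6" using side_hexagon[OF assms(2)] ab(1) by blast
    then show False using edges_hexagon(2)[OF assms(2)] e(1) by blast
  qed
  then show ?thesis by blast
qed

lemma hexagonal_move_swap:
  "hexagonal_move m T T' \<longleftrightarrow> (\<exists>u1 u2 u3 u4 u5 u6 A B.
     hexagon_in m T u1 u2 u3 u4 u5 u6 \<and> hexagon_swap u1 u2 u3 u4 u5 u6 A B \<and>
     T \<inter> hexagon_diagonals u1 u2 u3 u4 u5 u6 = A \<and> T' = (T - A) \<union> B)"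
  unfolding hexagonal_move_def hexagon_swap_def ..

lemma hexagonal_move_hmove:
  assumes "m \<ge> 1" "T \<inter> sides m = {}" "hexagonal_move m T T'"
  shows "hmove (T \<union> sides m) (T' \<union> sides m)" "T' \<inter> sides m = {}"
proof -
  obtain u1 u2 u3 u4 u5 u6 A B where hex: "hexagon_in m T u1 u2 u3 u4 u5 u6"
    and sw: "hexagon_swap u1 u2 u3 u4 u5 u6 A B"
    and A: "T \<inter> hexagon_diagonals u1 u2 u3 u4 u5 u6 = A" and T': "T' = (T - A) \<union> B"
    using assms(3) unfolding hexagonal_move_swap by blast
  have cyc: "cyclic_order [u1, u2, u3, u4, u5, u6]"
    and sides: "hexagon_sides u1 u2 u3 u4 u5 u6 \<subseteq> T \<union> sides m"
    and H: "{u1, u2, u3, u4, u5, u6} \<subseteq> {0..m}"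
    using hex unfolding hexagon_in_def hexagon_sides_def by auto
  note D = hexagon_diagonals_not_sides[OF assms(1) cyc H]
  have "(T \<union> sides m) \<inter> hexagon_diagonals u1 u2 u3 u4 u5 u6 = A"
    "T' \<union> sides m = ((T \<union> sides m) - A) \<union> B"
    using A T' D by blast+
  then show "hmove (T \<union> sides m) (T' \<union> sides m)" unfolding hmove_def using cyc sides sw by blast
  show "T' \<inter> sides m = {}" using T' D assms(2) hexagon_swap_diagonals(2)[OF sw] by blast
qed

lemma hmove_hexagonal_move:
  assumes "m \<ge> 1" "sides m \<subseteq> E" "tri {0..m} E" "hmove E E'"
  shows "hexagonal_move m (E - sides m) (E' - sides m)" "sides m \<subseteq> E'"
proof -
  obtain u1 u2 u3 u4 u5 u6 A B where cyc: "cyclic_order [u1, u2, u3, u4, u5, u6]"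
    and sides: "hexagon_sides u1 u2 u3 u4 u5 u6 \<subseteq> E" and sw: "hexagon_swap u1 u2 u3 u4 u5 u6 A B"
    and A: "E \<inter> hexagon_diagonals u1 u2 u3 u4 u5 u6 = A" and E': "E' = (E - A) \<union> B"
    using assms(4) unfolding hmove_def by blast
  have "{u1, u2} \<in> E" "{u3, u4} \<in> E" "{u5, u6} \<in> E"
    using sides unfolding hexagon_sides_def by blast+
  then have H: "{u1, u2, u3, u4, u5, u6} \<subseteq> {0..m}" using triD(1,2)[OF assms(3)] by blast
  note D = hexagon_diagonals_not_sides[OF assms(1) cyc H]
  have "sides m \<union> (E - sides m) = E" using assms(2) by blast
  then have hex: "hexagon_in m (E - sides m) u1 u2 u3 u4 u5 u6"
    unfolding hexagon_in_def using cyc H sides[unfolded hexagon_sides_def] by simp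
  have "(E - sides m) \<inter> hexagon_diagonals u1 u2 u3 u4 u5 u6 = A"
    "E' - sides m = ((E - sides m) - A) \<union> B"
    using A E' D hexagon_swap_diagonals(2)[OF sw] by blast+
  with hex sw show "hexagonal_move m (E - sides m) (E' - sides m)"
    unfolding hexagonal_move_swap by blast
  show "sides m \<subseteq> E'" using E' A D assms(2) by blast
qed

lemma hexagonal_moves_hmoves:
  assumes "m \<ge> 1" "T \<inter> sides m = {}" "(hexagonal_move m)\<^sup>*\<^sup>* T T'"
  shows "hmove\<^sup>*\<^sup>* (T \<union> sides m) (T' \<union> sides m)"
proof -
  have "hmove\<^sup>*\<^sup>* (T \<union> sides m) (T' \<union> sides m) \<and> T' \<inter> sides m = {}"
    using assms(3)
  proof induction
    case (step S S')
    then show ?case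
      using hexagonal_move_hmove[OF assms(1), of S S'] by (meson rtranclp.rtrancl_into_rtrancl)
  qed (use assms(2) in simp)
  then show ?thesis by blast
qed

lemma hmoves_hexagonal_moves:
  assumes "m \<ge> 1" "sides m \<subseteq> E" "tri {0..m} E" "hmove\<^sup>*\<^sup>* E E'"
  shows "(hexagonal_move m)\<^sup>*\<^sup>* (E - sides m) (E' - sides m)"
proof -
  have "(hexagonal_move m)\<^sup>*\<^sup>* (E - sides m) (E' - sides m) \<and> sides m \<subseteq> E' \<and> tri {0..m} E'"
    using assms(4)
  proof induction
    case (step F F')
    then show ?case
      using hmove_hexagonal_move[OF assms(1), of F F'] hmove_tri_proper(1)[of F F' "{0..m}"]
      by (meson finite_atLeastAtMost rtranclp.rtrancl_into_rtrancl)
  qed (use assms(2,3) in simp)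
  then show ?thesis by blast
qed

lemma hmoves_proper:
  assumes "hmove\<^sup>*\<^sup>* E F" "tri V E" "finite V" "proper y E"
  shows "proper y F"
proof -
  have "tri V F \<and> proper y F"
    using assms(1)
  proof induction
    case (step F G)
    then show ?case using hmove_tri_proper(1)[of F G V] hmove_tri_proper(2)[of F G V y] assms(3) by blast
  qed (use assms(2,4) in simp)
  then show ?thesis by blast
qed

section \<open>Colourings as lists, their existence and uniqueness\<close>

definition colours :: "nat \<Rightarrow> nat set set \<Rightarrow> f2p1 list \<Rightarrow> bool" where
  "colours m T y \<longleftrightarrow> y \<in> X_F2 m \<and> (\<forall>i\<le>m. \<forall>j\<le>m. {i, j} \<in> sides m \<union> T \<longrightarrow> y ! i \<noteq> y ! j)"

text \<open>The inequalities between consecutive entries in \<open>X_F2\<close> are instances of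
  properness on the sides.\<close>

lemma colours_proper:
  assumes "tri {0..m} (T \<union> sides m)"
  shows "colours m T y \<longleftrightarrow> length y = m + 1 \<and> y ! 0 = P_zero \<and> y ! m = P_inf \<and>
    proper ((!) y) (T \<union> sides m)"
proof -
  have le: "i \<le> m \<and> j \<le> m" if "{i, j} \<in> T \<union> sides m" for i j
    using triD(1,2)[OF assms that] by simp
  have "(\<forall>i\<le>m. \<forall>j\<le>m. {i, j} \<in> sides m \<union> T \<longrightarrow> y ! i \<noteq> y ! j) \<longleftrightarrow> proper ((!) y) (T \<union> sides m)"
    unfolding proper_def using le by (metis Un_commute)
  moreover have "y ! i \<noteq> y ! (i + 1)" if "proper ((!) y) (T \<union> sides m)" "i < m" for i
    using that(2) properD[OF that(1), of i "i + 1"] unfolding sides_def by blast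
  ultimately show ?thesis unfolding colours_def X_F2_def by blast
qed

text \<open>The side from \<open>m\<close> to \<open>0\<close> carries the two prescribed, distinct
  colours, so the results for functions apply. This gives the \<open>THE\<close> in
  \<open>coloring\<close> its meaning.\<close>

lemma ex1_colours:
  assumes "m \<ge> 1" "tri {0..m} (T \<union> sides m)"
  shows "\<exists>!y. colours m T y"
proof -
  have s: "side {0..m} m 0" using assms(1) unfolding side_def cy_def by auto
  obtain f where f: "f 0 = P_zero" "f m = P_inf" "proper f (T \<union> sides m)"
    using colouring_exists[OF assms(2) _ s f2p1_distinct(2)] by blast
  let ?y = "map f [0..<m + 1]"
  have nth: "?y ! i = f i" if "i \<le> m" for i
    using that by (simp del: upt_Suc)
  have "proper ((!) ?y) (T \<union> sides m)"
    unfolding proper_def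
  proof (intro allI impI)
    fix i j assume ij: "{i, j} \<in> T \<union> sides m"
    then have "i \<le> m" "j \<le> m" using triD(1,2)[OF assms(2)] by auto
    then show "?y ! i \<noteq> ?y ! j" using nth properD[OF f(3) ij] by metis
  qed
  then have "colours m T ?y"
    using nth[of 0] nth[of m] f(1,2) unfolding colours_proper[OF assms(2)] by simp
  moreover have "y = z" if "colours m T y" "colours m T z" for y z
  proof (rule nth_equalityI)
    note yz = that[unfolded colours_proper[OF assms(2)]]
    show "length y = length z" using yz by simp
    fix i assume "i < length y"
    then have "i \<in> {0..m}" using yz by simp
    then show "y ! i = z ! i"
      using colouring_unique[OF assms(2) _ s, of "(!) y" "(!) z" i] yz by simp
  qed
  ultimately show ?thesis by blast
qed

theorem theorem3p6:
  fixes m :: nat and T T' :: "nat set set"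
  assumes "m \<ge> 1"
    and "triangulation m T"
    and "triangulation m T'"
  shows "coloring m T = coloring m T' \<longleftrightarrow> (hexagonal_move m)\<^sup>*\<^sup>* T T'"
proof -
  note T = triangulation_tri[OF assms(1,2)] and T' = triangulation_tri[OF assms(1,3)]
  have coloring: "coloring m S = (THE y. colours m S y)" for S
    unfolding coloring_def colours_def ..
  note ex1 = ex1_colours[OF assms(1) T(1)] and ex1' = ex1_colours[OF assms(1) T'(1)]
  have c: "colours m T (coloring m T)" and c': "colours m T' (coloring m T')"
    unfolding coloring using theI'[OF ex1] theI'[OF ex1'] by auto
  note cp = colours_proper[OF T(1)] and cp' = colours_proper[OF T'(1)]
  show ?thesis
  proof
    assume "coloring m T = coloring m T'"
    then have "proper ((!) (coloring m T)) (T \<union> sides m)" "proper ((!) (coloring m T)) (T' \<union> sides m)"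
      using c c' unfolding cp cp' by auto
    then have "hmove\<^sup>*\<^sup>* (T \<union> sides m) (T' \<union> sides m)"
      using hmove_connected[of "{0..m}"] T(1) T'(1) by blast
    then have "(hexagonal_move m)\<^sup>*\<^sup>* (T \<union> sides m - sides m) (T' \<union> sides m - sides m)"
      using hmoves_hexagonal_moves[OF assms(1) _ T(1)] by blast
    moreover have "T \<union> sides m - sides m = T" "T' \<union> sides m - sides m = T'" using T(2) T'(2) by blast+
    ultimately show "(hexagonal_move m)\<^sup>*\<^sup>* T T'" by simp
  next
    assume "(hexagonal_move m)\<^sup>*\<^sup>* T T'"
    then have "hmove\<^sup>*\<^sup>* (T \<union> sides m) (T' \<union> sides m)"
      by (rule hexagonal_moves_hmoves[OF assms(1) T(2)])
    then have "proper ((!) (coloring m T)) (T' \<union> sides m)"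
      using hmoves_proper[OF _ T(1)] c unfolding cp by blast
    then have "colours m T' (coloring m T)" using c unfolding cp cp' by blast
    then show "coloring m T = coloring m T'" using ex1' c' by blast
  qed
qed

end
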